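(* (Bounded influence of the balanced estimator.) Let $0<\varepsilon<1$ and $I_\varepsilon=[\varepsilon,2-\varepsilon]$. For every $\alpha\in I_\varepsilon$, $m\in\mathcal M$ and $Z\notin\mathrm{Cut}(m)\cup\{m\}$, $$\|\psi_\alpha(Z;m)\|_{g_1}=\frac{\{A_m(Z)+B_m(Z)\}^{1/2}}{\{\alpha A_m(Z)+(2-\alpha)B_m(Z)\}^{1/2}}\le\frac1{\sqrt\varepsilon},\qquad|h_\alpha(Z;m)|\le1.$$ Consequently, if $(m_0,\alpha_0)\in\mathcal M\times I_\varepsilon$ satisfies $E[\Xi_{\alpha_0}(Z;m_0)]=0$ and the Jacobian $J=D_{(m,\alpha)}E[\Xi_\alpha(Z;m)]|_{(m_0,\alpha_0)}$ exists and is invertible, then the influence function $\mathrm{IF}_{\rm bal}(z)=-J^{-1}\Xi_{\alpha_0}(z;m_0)$ of the balanced estimator is bounded in $z$.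
   Context: Let $(M,g_M)$, $(N,g_N)$ be smooth, connected, complete Riemannian manifolds with geodesic distances $d_M,d_N$, $\mathcal M=M\times N$, $g_1=g_M\oplus g_N$. For $\alpha\in(0,2)$ let $d_\alpha((p,q),(x,y))=\{\alpha d_M(p,x)^2+(2-\alpha)d_N(q,y)^2\}^{1/2}$ and $\log_{(p,q)}(x,y)=(\log_px,\log_qy)$. For $m=(p,q)$ and $Z=(X,Y)\notin\mathrm{Cut}(m)\cup\{m\}$: $\psi_\alpha(Z;m)=\log_mZ/d_\alpha(m,Z)\in T_m\mathcal M$, $A_m(Z)=d_M(p,X)^2$, $B_m(Z)=d_N(q,Y)^2$, $h_\alpha(Z;m)=\{\alpha A_m(Z)-(2-\alpha)B_m(Z)\}/\{\alpha A_m(Z)+(2-\alpha)B_m(Z)\}$, and $\Xi_\alpha(Z;m)=(\psi_\alpha(Z;m),h_\alpha(Z;m))$, a vector of $\mathbb R^{\dim M+\dim N+1}$ in local coordinates around $m_0$. The influence function is considered at points $z\notin\mathrm{Cut}(m_0)\cup\{m_0\}$. *)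

theory Defs
  imports "HOL-Probability.Probability"
begin

section \<open>Smooth maps between normed spaces\<close>

text \<open>
  Both notions are only used on open sets \<open>S\<close> of a Euclidean space, where requiring every
  directional derivative of a differentiable map to be of class \<open>C\<^sup>k\<close> amounts to the map
  being of class \<open>C\<^sup>k\<^sup>+\<^sup>1\<close>.
\<close>

primrec Ck_on :: "nat \<Rightarrow> 'a::real_normed_vector set \<Rightarrow> ('a \<Rightarrow> 'b::real_normed_vector) \<Rightarrow> bool" where
  "Ck_on 0 S f \<longleftrightarrow> continuous_on S f"
| "Ck_on (Suc k) S f \<longleftrightarrow> (\<forall>x\<in>S. f differentiable (at x)) \<and>
     (\<forall>v. Ck_on k S (\<lambda>x. frechet_derivative f (at x) v))"

definition smooth_on :: "'a::real_normed_vector set \<Rightarrow> ('a \<Rightarrow> 'b::real_normed_vector) \<Rightarrow> bool" where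
  "smooth_on S f \<longleftrightarrow> (\<forall>k. Ck_on k S f)"


section \<open>Riemannian manifolds\<close>

text \<open>
  The points of a manifold are the elements of a Hausdorff, second countable type \<open>'m\<close>; the
  model space is the Euclidean space \<open>'e\<close>, so the dimension is \<open>DIM('e)\<close>.
\<close>

record ('m, 'e) chart =
  cdom :: "'m set"
  cmap :: "'m \<Rightarrow> 'e"
  cinv :: "'e \<Rightarrow> 'm"

definition is_chart :: "('m::topological_space, 'e::euclidean_space) chart \<Rightarrow> bool" where
  "is_chart c \<longleftrightarrow> open (cdom c) \<and> open (cmap c ` cdom c) \<and>
     homeomorphism (cdom c) (cmap c ` cdom c) (cmap c) (cinv c)"

definition compatible ::
    "('m::topological_space, 'e::euclidean_space) chart \<Rightarrow> ('m, 'e) chart \<Rightarrow> bool" where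
  "compatible c c' \<longleftrightarrow>
     smooth_on (cmap c ` (cdom c \<inter> cdom c')) (cmap c' \<circ> cinv c) \<and>
     smooth_on (cmap c' ` (cdom c \<inter> cdom c')) (cmap c \<circ> cinv c')"

text \<open>
  Each point \<open>p\<close> carries a preferred chart \<open>chart_at M p\<close> of the atlas. A tangent vector at
  \<open>p\<close> is represented by its coordinates in that chart, so every tangent space is a copy of \<open>'e\<close>,
  and \<open>metric M p\<close> is the inner product of the tangent space at \<open>p\<close> in this representation.
\<close>

record ('m, 'e) riem =
  atlas :: "('m, 'e) chart set"
  chart_at :: "'m \<Rightarrow> ('m, 'e) chart"
  metric :: "'m \<Rightarrow> 'e \<Rightarrow> 'e \<Rightarrow> real"

definition smooth_manifold :: "('m::{t2_space,second_countable_topology}, 'e::euclidean_space) riem \<Rightarrow> bool" where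
  "smooth_manifold M \<longleftrightarrow>
     (\<forall>c\<in>atlas M. is_chart c) \<and>
     (\<forall>c\<in>atlas M. \<forall>c'\<in>atlas M. compatible c c') \<and>
     (\<forall>p. chart_at M p \<in> atlas M \<and> p \<in> cdom (chart_at M p))"

text \<open>The charts of the maximal atlas, i.e. all local coordinate systems of the manifold.\<close>

definition charts :: "('m::topological_space, 'e::euclidean_space) riem \<Rightarrow> ('m, 'e) chart set" where
  "charts M = {c. is_chart c \<and> (\<forall>c'\<in>atlas M. compatible c c')}"

definition to_coord :: "('m, 'e::euclidean_space) riem \<Rightarrow> ('m, 'e) chart \<Rightarrow> 'm \<Rightarrow> 'e \<Rightarrow> 'e" where
  "to_coord M c p v =
     frechet_derivative (cmap c \<circ> cinv (chart_at M p)) (at (cmap (chart_at M p) p)) v"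

definition from_coord :: "('m, 'e::euclidean_space) riem \<Rightarrow> ('m, 'e) chart \<Rightarrow> 'm \<Rightarrow> 'e \<Rightarrow> 'e" where
  "from_coord M c p u = frechet_derivative (cmap (chart_at M p) \<circ> cinv c) (at (cmap c p)) u"

definition coord_metric ::
    "('m, 'e::euclidean_space) riem \<Rightarrow> ('m, 'e) chart \<Rightarrow> 'e \<Rightarrow> 'e \<Rightarrow> 'e \<Rightarrow> real" where
  "coord_metric M c x u v =
     metric M (cinv c x) (from_coord M c (cinv c x) u) (from_coord M c (cinv c x) v)"

definition riemannian_manifold ::
    "('m::{t2_space,second_countable_topology}, 'e::euclidean_space) riem \<Rightarrow> bool" where
  "riemannian_manifold M \<longleftrightarrow>
     smooth_manifold M \<and>
     (\<forall>p. bilinear (metric M p) \<and>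
          (\<forall>u v. metric M p u v = metric M p v u) \<and>
          (\<forall>v. v \<noteq> 0 \<longrightarrow> 0 < metric M p v v)) \<and>
     (\<forall>c\<in>atlas M. \<forall>u v. smooth_on (cmap c ` cdom c) (\<lambda>x. coord_metric M c x u v))"

definition tnorm :: "('m, 'e) riem \<Rightarrow> 'm \<Rightarrow> 'e \<Rightarrow> real" where
  "tnorm M p v = sqrt (metric M p v v)"


section \<open>Curves and the geodesic distance\<close>

definition smooth_curve ::
    "('m::topological_space, 'e::euclidean_space) riem \<Rightarrow> real set \<Rightarrow> (real \<Rightarrow> 'm) \<Rightarrow> bool" where
  "smooth_curve M J \<gamma> \<longleftrightarrow> open J \<and> continuous_on J \<gamma> \<and>
     (\<forall>c\<in>atlas M. smooth_on (J \<inter> \<gamma> -` cdom c) (cmap c \<circ> \<gamma>))"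

definition velocity :: "('m, 'e::euclidean_space) riem \<Rightarrow> (real \<Rightarrow> 'm) \<Rightarrow> real \<Rightarrow> 'e" where
  "velocity M \<gamma> t = vector_derivative (cmap (chart_at M (\<gamma> t)) \<circ> \<gamma>) (at t)"

text \<open>
  \<open>T\<close> contains the break points. The smooth pieces are closed arcs, so continuity at the break
  points is automatic.
\<close>

definition piecewise_smooth_curve ::
    "('m::topological_space, 'e::euclidean_space) riem \<Rightarrow> (real \<Rightarrow> 'm) \<Rightarrow> real \<Rightarrow> real \<Rightarrow> bool" where
  "piecewise_smooth_curve M \<gamma> a b \<longleftrightarrow>
     (\<exists>T. finite T \<and>
        (\<forall>s t. a \<le> s \<and> s < t \<and> t \<le> b \<and> {s<..<t} \<inter> T = {} \<longrightarrow>
           (\<exists>J \<sigma>. smooth_curve M J \<sigma> \<and> {s..t} \<subseteq> J \<and> (\<forall>u\<in>{s..t}. \<sigma> u = \<gamma> u))))"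

definition curve_length ::
    "('m, 'e::euclidean_space) riem \<Rightarrow> (real \<Rightarrow> 'm) \<Rightarrow> real \<Rightarrow> real \<Rightarrow> real" where
  "curve_length M \<gamma> a b = integral {a..b} (\<lambda>t. tnorm M (\<gamma> t) (velocity M \<gamma> t))"

definition geo_dist ::
    "('m::topological_space, 'e::euclidean_space) riem \<Rightarrow> 'm \<Rightarrow> 'm \<Rightarrow> real" where
  "geo_dist M p q =
     Inf {curve_length M \<gamma> 0 1 | \<gamma>. piecewise_smooth_curve M \<gamma> 0 1 \<and> \<gamma> 0 = p \<and> \<gamma> 1 = q}"

definition complete_connected_riemannian_manifold ::
    "('m::{t2_space,second_countable_topology}, 'e::euclidean_space) riem \<Rightarrow> bool" where
  "complete_connected_riemannian_manifold M \<longleftrightarrow>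
     riemannian_manifold M \<and> connected (UNIV :: 'm set) \<and>
     Metric_space.mcomplete UNIV (geo_dist M)"


section \<open>Geodesics, cut locus and Riemannian logarithm\<close>

text \<open>
  Christoffel symbols of the first kind of the Levi-Civita connection in the chart \<open>c\<close>,
  contracted with coordinate vectors:
  \<open>\<Gamma>(u,v;w) = (\<partial>\<^sub>u g(v,w) + \<partial>\<^sub>v g(u,w) - \<partial>\<^sub>w g(u,v)) / 2\<close>.
\<close>

definition christoffel ::
    "('m, 'e::euclidean_space) riem \<Rightarrow> ('m, 'e) chart \<Rightarrow> 'e \<Rightarrow> 'e \<Rightarrow> 'e \<Rightarrow> 'e \<Rightarrow> real" where
  "christoffel M c x u v w =
     (frechet_derivative (\<lambda>y. coord_metric M c y v w) (at x) u
      + frechet_derivative (\<lambda>y. coord_metric M c y u w) (at x) v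
      - frechet_derivative (\<lambda>y. coord_metric M c y u v) (at x) w) / 2"

text \<open>
  The geodesic equation with lowered index: in every chart of the atlas the coordinate curve
  \<open>x\<close> satisfies \<open>g(x'', w) + \<Gamma>(x', x'; w) = 0\<close> for all \<open>w\<close>.
\<close>

definition geodesic ::
    "('m::topological_space, 'e::euclidean_space) riem \<Rightarrow> real set \<Rightarrow> (real \<Rightarrow> 'm) \<Rightarrow> bool" where
  "geodesic M J \<gamma> \<longleftrightarrow> smooth_curve M J \<gamma> \<and>
     (\<forall>c\<in>atlas M. \<forall>t\<in>J. \<gamma> t \<in> cdom c \<longrightarrow>
       (let x = cmap c \<circ> \<gamma>;
            x' = (\<lambda>s. vector_derivative x (at s));
            x'' = (\<lambda>s. vector_derivative x' (at s))
        in \<forall>w. coord_metric M c (x t) (x'' t) w + christoffel M c (x t) (x' t) (x' t) w = 0))"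

definition minimizing_geodesic ::
    "('m::topological_space, 'e::euclidean_space) riem \<Rightarrow> (real \<Rightarrow> 'm) \<Rightarrow> real \<Rightarrow> real \<Rightarrow> bool" where
  "minimizing_geodesic M \<gamma> a b \<longleftrightarrow>
     (\<exists>J. {a..b} \<subseteq> J \<and> geodesic M J \<gamma>) \<and>
     curve_length M \<gamma> a b = geo_dist M (\<gamma> a) (\<gamma> b)"

text \<open>
  The points at which the geodesics from \<open>p\<close> stop being minimizing. On a complete connected
  manifold every point is reached by a minimizing geodesic (Hopf--Rinow), and only by one if that
  one remains minimizing beyond the point; the universal quantifier over minimizing geodesics
  could therefore equivalently be existential.
\<close>

definition cut_locus ::
    "('m::topological_space, 'e::euclidean_space) riem \<Rightarrow> 'm \<Rightarrow> 'm set" where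
  "cut_locus M p =
     {x. \<forall>\<gamma>. minimizing_geodesic M \<gamma> 0 1 \<and> \<gamma> 0 = p \<and> \<gamma> 1 = x \<longrightarrow>
             \<not> (\<exists>s>1. minimizing_geodesic M \<gamma> 0 s)}"

text \<open>
  The initial velocity of the minimizing geodesic from \<open>p\<close> at time \<open>0\<close> to \<open>x\<close> at time \<open>1\<close>, which
  is unique for \<open>x\<close> outside the cut locus of \<open>p\<close>. The value on the cut locus is arbitrary and
  never used.
\<close>

definition riem_log ::
    "('m::topological_space, 'e::euclidean_space) riem \<Rightarrow> 'm \<Rightarrow> 'm \<Rightarrow> 'e" where
  "riem_log M p x =
     (SOME v. \<exists>\<gamma>. minimizing_geodesic M \<gamma> 0 1 \<and> \<gamma> 0 = p \<and> \<gamma> 1 = x \<and> velocity M \<gamma> 0 = v)"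


section \<open>The Riemannian product\<close>

definition prod_chart :: "('m, 'e) chart \<Rightarrow> ('n, 'f) chart \<Rightarrow> ('m \<times> 'n, 'e \<times> 'f) chart" where
  "prod_chart c c' =
     \<lparr>cdom = cdom c \<times> cdom c', cmap = map_prod (cmap c) (cmap c'), cinv = map_prod (cinv c) (cinv c')\<rparr>"

definition prod_riem :: "('m, 'e) riem \<Rightarrow> ('n, 'f) riem \<Rightarrow> ('m \<times> 'n, 'e \<times> 'f) riem" where
  "prod_riem M N =
     \<lparr>atlas = {prod_chart c c' | c c'. c \<in> atlas M \<and> c' \<in> atlas N},
      chart_at = (\<lambda>m. prod_chart (chart_at M (fst m)) (chart_at N (snd m))),
      metric = (\<lambda>m v w. metric M (fst m) (fst v) (fst w) + metric N (snd m) (snd v) (snd w))\<rparr>"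


section \<open>The balanced estimator\<close>

context
  fixes M :: "('m::{t2_space,second_countable_topology}, 'e::euclidean_space) riem"
    and N :: "('n::{t2_space,second_countable_topology}, 'f::euclidean_space) riem"
begin

definition A_sq :: "'m \<times> 'n \<Rightarrow> 'm \<times> 'n \<Rightarrow> real" where
  "A_sq m Z = (geo_dist M (fst m) (fst Z))\<^sup>2"

definition B_sq :: "'m \<times> 'n \<Rightarrow> 'm \<times> 'n \<Rightarrow> real" where
  "B_sq m Z = (geo_dist N (snd m) (snd Z))\<^sup>2"

definition d_alpha :: "real \<Rightarrow> 'm \<times> 'n \<Rightarrow> 'm \<times> 'n \<Rightarrow> real" where
  "d_alpha \<alpha> m Z =
     sqrt (\<alpha> * (geo_dist M (fst m) (fst Z))\<^sup>2 + (2 - \<alpha>) * (geo_dist N (snd m) (snd Z))\<^sup>2)"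

definition prod_log :: "'m \<times> 'n \<Rightarrow> 'm \<times> 'n \<Rightarrow> 'e \<times> 'f" where
  "prod_log m Z = (riem_log M (fst m) (fst Z), riem_log N (snd m) (snd Z))"

definition psi :: "real \<Rightarrow> 'm \<times> 'n \<Rightarrow> 'm \<times> 'n \<Rightarrow> 'e \<times> 'f" where
  "psi \<alpha> Z m = prod_log m Z /\<^sub>R d_alpha \<alpha> m Z"

definition h_bal :: "real \<Rightarrow> 'm \<times> 'n \<Rightarrow> 'm \<times> 'n \<Rightarrow> real" where
  "h_bal \<alpha> Z m =
     (\<alpha> * A_sq m Z - (2 - \<alpha>) * B_sq m Z) / (\<alpha> * A_sq m Z + (2 - \<alpha>) * B_sq m Z)"

text \<open>The set on which \<open>\<psi>\<^sub>\<alpha>(\<cdot>; m)\<close> and \<open>h\<^sub>\<alpha>(\<cdot>; m)\<close> are defined.\<close>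

definition regular_set :: "'m \<times> 'n \<Rightarrow> ('m \<times> 'n) set" where
  "regular_set m = - (cut_locus (prod_riem M N) m \<union> {m})"

text \<open>\<open>\<Xi>\<^sub>\<alpha>(Z; m)\<close> in the local coordinates of a chart \<open>c\<close> of the product around \<open>m\<close>.\<close>

definition Xi ::
    "('m \<times> 'n, 'e \<times> 'f) chart \<Rightarrow> real \<Rightarrow> 'm \<times> 'n \<Rightarrow> 'm \<times> 'n \<Rightarrow> ('e \<times> 'f) \<times> real" where
  "Xi c \<alpha> Z m = (to_coord (prod_riem M N) c m (psi \<alpha> Z m), h_bal \<alpha> Z m)"

text \<open>
  The Bochner integral of a non-integrable function is \<open>0\<close>, so a statement about
  \<open>E[\<Xi>\<^sub>\<alpha>(Z; m)]\<close> has to be accompanied by the assertion that this expectation exists.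
\<close>

definition Xi_mean_exists ::
    "('m \<times> 'n, 'e \<times> 'f) chart \<Rightarrow> 'w measure \<Rightarrow> ('w \<Rightarrow> 'm \<times> 'n) \<Rightarrow> real \<Rightarrow> 'm \<times> 'n \<Rightarrow> bool" where
  "Xi_mean_exists c P Z \<alpha> m \<longleftrightarrow>
     (AE \<omega> in P. Z \<omega> \<in> regular_set m) \<and> integrable P (\<lambda>\<omega>. Xi c \<alpha> (Z \<omega>) m)"

definition Xi_mean ::
    "('m \<times> 'n, 'e \<times> 'f) chart \<Rightarrow> 'w measure \<Rightarrow> ('w \<Rightarrow> 'm \<times> 'n) \<Rightarrow> real \<Rightarrow> 'm \<times> 'n \<Rightarrow> ('e \<times> 'f) \<times> real" where
  "Xi_mean c P Z \<alpha> m = (\<integral>\<omega>. Xi c \<alpha> (Z \<omega>) m \<partial>P)"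

text \<open>
  \<open>J\<close> is the derivative of \<open>(m, \<alpha>) \<mapsto> E[\<Xi>\<^sub>\<alpha>(Z; m)]\<close> at \<open>(m\<^sub>0, \<alpha>\<^sub>0)\<close> in the coordinates of \<open>c\<close>;
  for it to make sense the expectation has to exist near \<open>(m\<^sub>0, \<alpha>\<^sub>0)\<close>.
\<close>

definition has_Xi_Jacobian ::
    "('m \<times> 'n, 'e \<times> 'f) chart \<Rightarrow> 'w measure \<Rightarrow> ('w \<Rightarrow> 'm \<times> 'n) \<Rightarrow> real \<Rightarrow> 'm \<times> 'n
     \<Rightarrow> (('e \<times> 'f) \<times> real \<Rightarrow> ('e \<times> 'f) \<times> real) \<Rightarrow> bool" where
  "has_Xi_Jacobian c P Z \<alpha>\<^sub>0 m\<^sub>0 J \<longleftrightarrow>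
     (\<forall>\<^sub>F (x, \<alpha>) in nhds (cmap c m\<^sub>0, \<alpha>\<^sub>0). Xi_mean_exists c P Z \<alpha> (cinv c x)) \<and>
     ((\<lambda>(x, \<alpha>). Xi_mean c P Z \<alpha> (cinv c x)) has_derivative J) (at (cmap c m\<^sub>0, \<alpha>\<^sub>0))"

definition IF_bal ::
    "('m \<times> 'n, 'e \<times> 'f) chart \<Rightarrow> (('e \<times> 'f) \<times> real \<Rightarrow> ('e \<times> 'f) \<times> real) \<Rightarrow> real \<Rightarrow> 'm \<times> 'n
     \<Rightarrow> 'm \<times> 'n \<Rightarrow> ('e \<times> 'f) \<times> real" where
  "IF_bal c J \<alpha>\<^sub>0 m\<^sub>0 z = - inv J (Xi c \<alpha>\<^sub>0 z m\<^sub>0)"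

end

end

theory Submission
  imports Defs
begin

text \<open>
  A point outside the cut locus of \<open>m\<close> is joined to \<open>m\<close> by a minimizing geodesic of the product.
  Its components are geodesics, hence of constant speeds \<open>a\<close> and \<open>b\<close>, and \<open>a\<^sup>2 + b\<^sup>2\<close> is the
  squared distance in the product. That squared distance is at most \<open>d\<^sub>M\<^sup>2 + d\<^sub>N\<^sup>2\<close>, so that
  \<open>a = d\<^sub>M\<close> and \<open>b = d\<^sub>N\<close>: the components are minimizing, and the two logarithms have norms
  \<open>d\<^sub>M\<close> and \<open>d\<^sub>N\<close>. The bounds then follow from
  \<open>\<alpha> A + (2 - \<alpha>) B \<ge> \<epsilon> (A + B)\<close>, together with the equivalence of norms in finite dimension.
\<close>

section \<open>Smooth maps\<close>

text \<open>The distance inequality is the hard step. Pairing two curves over [0,1] with speeds a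
  and b gives the length of the pair as the integral of sqrt(a^2 + b^2). By Minkowski this is at
  least sqrt(L^2 + K^2) for the two lengths L and K, and strictly more unless the speeds are
  proportional. So short curves of the factors must first be reparametrized to have speed at most
  about their length. Since the distance is an infimum, an arbitrarily small loss of length in doing
  so is harmless.

  The geodesic to start from comes from the form of \<open>cut_locus\<close>: a point reached by no
  minimizing geodesic satisfies the universal condition vacuously and so lies in the cut locus.

  The manifold axioms are given for the two factors, and facts about the product are derived from
  them. Lemmas applied to both kinds of spaces therefore assume only what can be read off
  \<open>prod_riem M N\<close>, such as nonnegativity of the metric.\<close>

lemma Ck_on_subset:
  assumes "Ck_on k S f" and "T \<subseteq> S"
  shows "Ck_on k T f"
  using assms
proof (induction k arbitrary: f)
  case 0
  then show ?case by (auto intro: continuous_on_subset)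
next
  case (Suc k)
  then show ?case by (simp add: subset_iff)
qed

text \<open>Derivatives are local: on the open set \<open>S\<close> the two functions agree near
  every point, so each derivative of \<open>f\<close> is one of \<open>g\<close>, and the induction
  continues with the directional derivatives.\<close>

lemma Ck_on_cong:
  assumes "Ck_on k S f" and "open S" and "\<And>x. x \<in> S \<Longrightarrow> f x = g x"
  shows "Ck_on k S g"
  using assms(1,3)
proof (induction k arbitrary: f g)
  case 0
  then show ?case by (metis Ck_on.simps(1) continuous_on_cong)
next
  case (Suc k)
  have diff: "f differentiable at x" if "x \<in> S" for x
    using Suc.prems(1) that by simp
  have der: "(g has_derivative frechet_derivative f (at x)) (at x)" if "x \<in> S" for x
    by (rule has_derivative_transform_within_open[OF _ \<open>open S\<close> that Suc.prems(2)])
      (use diff[OF that] frechet_derivative_works in blast)+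
  have "Ck_on k S (\<lambda>x. frechet_derivative g (at x) v)" for v
  proof (rule Suc.IH)
    show "Ck_on k S (\<lambda>x. frechet_derivative f (at x) v)"
      using Suc.prems(1) by simp
  qed (metis der frechet_derivative_at)
  then show ?case
    using der by (auto simp: differentiable_def)
qed

text \<open>Gluing is needed for the components of a curve in a product: the preimage of a chart of
  one factor is covered by the preimages of product charts, no single one of which need contain
  it.\<close>

lemma Ck_on_Union:
  assumes "\<And>i. i \<in> I \<Longrightarrow> open (S i)" and "\<And>i. i \<in> I \<Longrightarrow> Ck_on k (S i) f"
  shows "Ck_on k (\<Union>i\<in>I. S i) f"
  using assms(2)
proof (induction k arbitrary: f)
  case 0
  then show ?case using assms(1) by (auto intro: continuous_on_open_UN)
next
  case (Suc k)
  then show ?case by auto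
qed

text \<open>The chain rule turns the direction \<open>v\<close> into \<open>a * v\<close>. For fixed
  \<open>v\<close> the result is again a directional derivative of \<open>f\<close> composed with
  the same affine map, so the induction closes.\<close>

lemma Ck_on_affine:
  fixes f :: "real \<Rightarrow> 'b::real_normed_vector"
  assumes "Ck_on k S f" and "open S"
  shows "Ck_on k ((\<lambda>t. a * t + b) -` S) (\<lambda>t. f (a * t + b))"
  using assms(1)
proof (induction k arbitrary: f)
  case 0
  then show ?case
    by (auto intro!: continuous_on_compose2[of S f "(\<lambda>t. a * t + b) -` S" "\<lambda>t. a * t + b"] continuous_intros)
next
  case (Suc k)
  let ?T = "(\<lambda>t. a * t + b) -` S"
  have opn: "open ?T"
    by (intro open_vimage \<open>open S\<close> continuous_intros)
  have der: "((\<lambda>t. f (a * t + b)) has_derivative (\<lambda>v. frechet_derivative f (at (a * t + b)) (a * v))) (at t)"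
    if "t \<in> ?T" for t
  proof -
    have "(f has_derivative frechet_derivative f (at (a * t + b))) (at (a * t + b))"
      using Suc.prems that by (simp add: frechet_derivative_works)
    moreover have "((\<lambda>t. a * t + b) has_derivative (\<lambda>v. a * v)) (at t)"
      by (auto intro!: derivative_eq_intros)
    ultimately show ?thesis
      using diff_chain_at[of "\<lambda>t. a * t + b" _ t f] by (simp add: o_def)
  qed
  have "Ck_on k ?T (\<lambda>t. frechet_derivative (\<lambda>t. f (a * t + b)) (at t) v)" for v
  proof (rule Ck_on_cong[OF _ opn])
    show "Ck_on k ?T (\<lambda>t. frechet_derivative f (at (a * t + b)) (a * v))"
      using Suc.prems by (intro Suc.IH[of "\<lambda>x. frechet_derivative f (at x) (a * v)"]) auto
  qed (simp flip: frechet_derivative_at[OF der])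
  then show ?case
    using der by (auto simp: differentiable_def)
qed

lemma Ck_on_Pair:
  assumes "Ck_on k S f" and "Ck_on k S g" and "open S"
  shows "Ck_on k S (\<lambda>x. (f x, g x))"
  using assms(1,2)
proof (induction k arbitrary: f g)
  case 0
  then show ?case by (auto intro: continuous_intros)
next
  case (Suc k)
  have der: "((\<lambda>x. (f x, g x)) has_derivative
      (\<lambda>v. (frechet_derivative f (at x) v, frechet_derivative g (at x) v))) (at x)" if "x \<in> S" for x
    using Suc.prems that by (intro has_derivative_Pair) (auto simp flip: frechet_derivative_works)
  have "Ck_on k S (\<lambda>x. frechet_derivative (\<lambda>x. (f x, g x)) (at x) v)" for v
  proof (rule Ck_on_cong[OF _ \<open>open S\<close>])
    show "Ck_on k S (\<lambda>x. (frechet_derivative f (at x) v, frechet_derivative g (at x) v))"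
      using Suc.prems by (intro Suc.IH) auto
  qed (simp flip: frechet_derivative_at[OF der])
  then show ?case
    using der by (auto simp: differentiable_def)
qed

lemma Ck_on_bounded_linear:
  assumes "Ck_on k S f" and "open S" and "bounded_linear L"
  shows "Ck_on k S (\<lambda>x. L (f x))"
  using assms(1)
proof (induction k arbitrary: f)
  case 0
  then show ?case using assms(3) by (auto intro: bounded_linear.continuous_on)
next
  case (Suc k)
  have der: "((\<lambda>x. L (f x)) has_derivative (\<lambda>v. L (frechet_derivative f (at x) v))) (at x)"
    if "x \<in> S" for x
    using Suc.prems that
    by (intro bounded_linear.has_derivative[OF assms(3)]) (auto simp flip: frechet_derivative_works)
  have "Ck_on k S (\<lambda>x. frechet_derivative (\<lambda>x. L (f x)) (at x) v)" for v
  proof (rule Ck_on_cong[OF _ \<open>open S\<close>])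
    show "Ck_on k S (\<lambda>x. L (frechet_derivative f (at x) v))"
      using Suc.prems by (intro Suc.IH) auto
  qed (simp flip: frechet_derivative_at[OF der])
  then show ?case
    using der by (auto simp: differentiable_def)
qed

lemma smooth_on_subset: "smooth_on S f \<Longrightarrow> T \<subseteq> S \<Longrightarrow> smooth_on T f"
  by (auto simp: smooth_on_def intro: Ck_on_subset)

lemma smooth_on_cong:
  "smooth_on S f \<Longrightarrow> open S \<Longrightarrow> (\<And>x. x \<in> S \<Longrightarrow> f x = g x) \<Longrightarrow> smooth_on S g"
  unfolding smooth_on_def using Ck_on_cong by blast

lemma smooth_on_differentiable:
  assumes "smooth_on S f" and "x \<in> S"
  shows "f differentiable at x"
  using assms unfolding smooth_on_def by (metis Ck_on.simps(2))

lemma smooth_on_has_derivative: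
  "smooth_on S f \<Longrightarrow> x \<in> S \<Longrightarrow> (f has_derivative frechet_derivative f (at x)) (at x)"
  using smooth_on_differentiable frechet_derivative_works by blast

lemma smooth_on_has_vector_derivative:
  fixes f :: "real \<Rightarrow> 'b::real_normed_vector"
  assumes "smooth_on S f" and "x \<in> S"
  shows "(f has_vector_derivative vector_derivative f (at x)) (at x)"
  using smooth_on_differentiable[OF assms] by (simp add: vector_derivative_works)

text \<open>On the line the vector derivative is the directional derivative in direction 1, which
  \<open>Ck_on\<close> controls at one order less.\<close>

lemma smooth_on_vector_derivative:
  fixes f :: "real \<Rightarrow> 'b::real_normed_vector"
  assumes "smooth_on S f" and "open S"
  shows "smooth_on S (\<lambda>x. vector_derivative f (at x))"
proof (rule smooth_on_cong[OF _ \<open>open S\<close>])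
  show "smooth_on S (\<lambda>x. frechet_derivative f (at x) 1)"
    using assms(1) unfolding smooth_on_def by (metis Ck_on.simps(2))
next
  fix x assume "x \<in> S"
  then have "(f has_vector_derivative vector_derivative f (at x)) (at x)"
    by (rule smooth_on_has_vector_derivative[OF assms(1)])
  then have "frechet_derivative f (at x) = (\<lambda>h. h *\<^sub>R vector_derivative f (at x))"
    by (metis has_vector_derivative_def frechet_derivative_at)
  then show "frechet_derivative f (at x) 1 = vector_derivative f (at x)"
    by simp
qed

section \<open>Speed of curves\<close>

lemma chart_inverse:
  assumes "smooth_manifold M" and "c \<in> atlas M" and "p \<in> cdom c"
  shows "cinv c (cmap c p) = p"
  using assms unfolding smooth_manifold_def is_chart_def homeomorphism_def by blast

lemma open_chart:
  assumes "smooth_manifold M" and "c \<in> atlas M"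
  shows "open (cdom c)" and "open (cmap c ` cdom c)"
  using assms unfolding smooth_manifold_def is_chart_def by blast+

lemma chart_at_atlas:
  assumes "smooth_manifold M"
  shows "chart_at M p \<in> atlas M" and "p \<in> cdom (chart_at M p)"
  using assms unfolding smooth_manifold_def by blast+

lemma transition_has_derivative:
  assumes "smooth_manifold M" and "c \<in> atlas M" and "c' \<in> atlas M" and "p \<in> cdom c" and "p \<in> cdom c'"
  shows "((cmap c' \<circ> cinv c) has_derivative
           frechet_derivative (cmap c' \<circ> cinv c) (at (cmap c p))) (at (cmap c p))"
proof -
  have "smooth_on (cmap c ` (cdom c \<inter> cdom c')) (cmap c' \<circ> cinv c)"
    using assms unfolding smooth_manifold_def compatible_def by blast
  then show ?thesis
    by (rule smooth_on_has_derivative) (use assms in blast)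
qed

lemma from_coord_has_derivative:
  assumes "smooth_manifold M" and "c \<in> atlas M" and "p \<in> cdom c"
  shows "((cmap (chart_at M p) \<circ> cinv c) has_derivative from_coord M c p) (at (cmap c p))"
proof -
  have "from_coord M c p = frechet_derivative (cmap (chart_at M p) \<circ> cinv c) (at (cmap c p))"
    by (auto simp: from_coord_def)
  then show ?thesis
    using transition_has_derivative[OF assms(1,2) chart_at_atlas(1)[OF assms(1)] assms(3) chart_at_atlas(2)[OF assms(1)]]
    by simp
qed

lemma open_chart_preimage:
  assumes "smooth_manifold M" and "smooth_curve M J \<gamma>" and "c \<in> atlas M"
  shows "open (J \<inter> \<gamma> -` cdom c)"
  using assms open_chart(1)[OF assms(1,3)] unfolding smooth_curve_def
  by (metis continuous_open_preimage)

lemma smooth_curve_coord: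
  assumes "smooth_manifold M" and "smooth_curve M J \<gamma>" and "c \<in> atlas M" and "t \<in> J" and "\<gamma> t \<in> cdom c"
  shows "((cmap c \<circ> \<gamma>) has_vector_derivative vector_derivative (cmap c \<circ> \<gamma>) (at t)) (at t)"
    and "((\<lambda>s. vector_derivative (cmap c \<circ> \<gamma>) (at s)) has_vector_derivative
           vector_derivative (\<lambda>s. vector_derivative (cmap c \<circ> \<gamma>) (at s)) (at t)) (at t)"
proof -
  have sm: "smooth_on (J \<inter> \<gamma> -` cdom c) (cmap c \<circ> \<gamma>)"
    using assms unfolding smooth_curve_def by blast
  show "((cmap c \<circ> \<gamma>) has_vector_derivative vector_derivative (cmap c \<circ> \<gamma>) (at t)) (at t)"
    by (rule smooth_on_has_vector_derivative[OF sm]) (use assms in auto)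
  show "((\<lambda>s. vector_derivative (cmap c \<circ> \<gamma>) (at s)) has_vector_derivative
           vector_derivative (\<lambda>s. vector_derivative (cmap c \<circ> \<gamma>) (at s)) (at t)) (at t)"
    using smooth_on_vector_derivative[OF sm open_chart_preimage[OF assms(1-3)]]
    by (rule smooth_on_has_vector_derivative) (use assms in auto)
qed

text \<open>\<open>velocity\<close> uses the chart preferred at the current point, which may jump
  along the curve, so it cannot be differentiated directly. The chain rule through the transition
  map expresses it in one fixed chart along the whole preimage of that chart.\<close>

lemma velocity_from_coord:
  assumes "smooth_manifold M" and "smooth_curve M J \<gamma>" and "c \<in> atlas M" and "t \<in> J" and "\<gamma> t \<in> cdom c"
  shows "velocity M \<gamma> t = from_coord M c (\<gamma> t) (vector_derivative (cmap c \<circ> \<gamma>) (at t))"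
proof -
  let ?S = "J \<inter> \<gamma> -` cdom c" and ?d = "chart_at M (\<gamma> t)"
  let ?F = "from_coord M c (\<gamma> t)"
  have x: "((cmap c \<circ> \<gamma>) has_derivative (\<lambda>h. h *\<^sub>R vector_derivative (cmap c \<circ> \<gamma>) (at t))) (at t)"
    using smooth_curve_coord(1)[OF assms] by (simp add: has_vector_derivative_def)
  have F: "((cmap ?d \<circ> cinv c) has_derivative ?F) (at ((cmap c \<circ> \<gamma>) t))"
    using from_coord_has_derivative[OF assms(1,3,5)] by simp
  have "((cmap ?d \<circ> cinv c) \<circ> (cmap c \<circ> \<gamma>) has_derivative
      ?F \<circ> (\<lambda>h. h *\<^sub>R vector_derivative (cmap c \<circ> \<gamma>) (at t))) (at t)"
    by (rule diff_chain_at[OF x F])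
  then have "((cmap ?d \<circ> cinv c) \<circ> (cmap c \<circ> \<gamma>) has_vector_derivative
      ?F (vector_derivative (cmap c \<circ> \<gamma>) (at t))) (at t)"
    using linear_scale[OF has_derivative_linear[OF F]]
    by (simp add: has_vector_derivative_def o_def)
  then have "((cmap ?d \<circ> \<gamma>) has_vector_derivative
      ?F (vector_derivative (cmap c \<circ> \<gamma>) (at t))) (at t)"
    by (rule has_vector_derivative_transform_within_open[OF _ open_chart_preimage[OF assms(1-3)]])
      (use assms chart_inverse[OF assms(1,3)] in auto)
  then show ?thesis
    unfolding velocity_def by (rule vector_derivative_at)
qed

section \<open>The metric in coordinates and the speed of geodesics\<close>

lemma riemannian_smooth: "riemannian_manifold M \<Longrightarrow> smooth_manifold M"
  by (simp add: riemannian_manifold_def)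

lemma bilinear_metric: "riemannian_manifold M \<Longrightarrow> bilinear (metric M p)"
  by (simp add: riemannian_manifold_def)

lemma metric_pos: "riemannian_manifold M \<Longrightarrow> v \<noteq> 0 \<Longrightarrow> 0 < metric M p v v"
  by (simp add: riemannian_manifold_def)

lemma metric_nonneg: "riemannian_manifold M \<Longrightarrow> 0 \<le> metric M p v v"
  by (cases "v = 0") (auto simp: bilinear_lzero[OF bilinear_metric] less_imp_le metric_pos)

lemma bilinear_coord_metric:
  assumes "riemannian_manifold M" and "c \<in> atlas M" and "y \<in> cmap c ` cdom c"
  shows "bilinear (coord_metric M c y)"
proof -
  obtain p where p: "p \<in> cdom c" "y = cmap c p"
    using assms(3) by blast
  have inv: "cinv c y = p"
    using p chart_inverse[OF riemannian_smooth[OF assms(1)] assms(2)] by simp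
  have "linear (from_coord M c p)"
    using from_coord_has_derivative[OF riemannian_smooth[OF assms(1)] assms(2) p(1)]
    by (rule has_derivative_linear)
  then show ?thesis
    using bilinear_metric[OF assms(1)] inv
    by (auto simp: bilinear_def coord_metric_def linear_iff)
qed

text \<open>Smoothness of the metric is given only for fixed coordinate vectors. The expansion
  reduces the metric on moving vectors to finitely many smooth scalar functions, to which the
  product rule applies.\<close>

lemma coord_metric_expand:
  assumes "riemannian_manifold M" and "c \<in> atlas M" and "y \<in> cmap c ` cdom c"
  shows "coord_metric M c y u v =
    (\<Sum>(i,j)\<in>Basis \<times> Basis. (u \<bullet> i) * (v \<bullet> j) * coord_metric M c y i j)"
proof -
  note bil = bilinear_coord_metric[OF assms]
  have "coord_metric M c y u v =
      coord_metric M c y (\<Sum>i\<in>Basis. (u \<bullet> i) *\<^sub>R i) (\<Sum>j\<in>Basis. (v \<bullet> j) *\<^sub>R j)"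
    by (simp only: euclidean_representation)
  also have "\<dots> = (\<Sum>(i,j)\<in>Basis \<times> Basis. (u \<bullet> i) * (v \<bullet> j) * coord_metric M c y i j)"
    unfolding bilinear_sum[OF bil]
    by (simp add: bilinear_lmul[OF bil] bilinear_rmul[OF bil] case_prod_unfold ac_simps)
  finally show ?thesis .
qed

lemma coord_metric_has_derivative:
  assumes "riemannian_manifold M" and "c \<in> atlas M" and "y \<in> cmap c ` cdom c"
  shows "((\<lambda>x. coord_metric M c x u v) has_derivative
    frechet_derivative (\<lambda>x. coord_metric M c x u v) (at y)) (at y)"
proof (rule smooth_on_has_derivative[OF _ assms(3)])
  show "smooth_on (cmap c ` cdom c) (\<lambda>x. coord_metric M c x u v)"
    using assms(1,2) by (simp add: riemannian_manifold_def)
qed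

lemma coord_metric_sym:
  "riemannian_manifold M \<Longrightarrow> coord_metric M c y u v = coord_metric M c y v u"
  by (simp add: coord_metric_def riemannian_manifold_def)

lemma metric_velocity:
  assumes "smooth_manifold M" and "smooth_curve M J \<gamma>" and "c \<in> atlas M" and "t \<in> J" and "\<gamma> t \<in> cdom c"
  shows "metric M (\<gamma> t) (velocity M \<gamma> t) (velocity M \<gamma> t) =
    coord_metric M c ((cmap c \<circ> \<gamma>) t) (vector_derivative (cmap c \<circ> \<gamma>) (at t))
      (vector_derivative (cmap c \<circ> \<gamma>) (at t))"
  using chart_inverse[OF assms(1,3,5)]
  by (simp add: velocity_from_coord[OF assms] coord_metric_def)

text \<open>Half of the derivative is the left-hand side of the geodesic equation, tested with \<open>w = x'\<close>.\<close>

lemma speed_squared_has_derivative: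
  assumes M: "riemannian_manifold M" and \<gamma>: "smooth_curve M J \<gamma>" and c: "c \<in> atlas M"
    and t: "t \<in> J" "\<gamma> t \<in> cdom c"
  defines "x \<equiv> cmap c \<circ> \<gamma>"
  defines "x' \<equiv> \<lambda>s. vector_derivative x (at s)"
  defines "x'' \<equiv> \<lambda>s. vector_derivative x' (at s)"
  shows "((\<lambda>s. metric M (\<gamma> s) (velocity M \<gamma> s) (velocity M \<gamma> s)) has_real_derivative
    2 * (coord_metric M c (x t) (x'' t) (x' t) + christoffel M c (x t) (x' t) (x' t) (x' t))) (at t)"
proof -
  let ?S = "J \<inter> \<gamma> -` cdom c" and ?G = "coord_metric M c"
  let ?I = "Basis \<times> Basis :: ('b \<times> 'b) set"
  note SM = riemannian_smooth[OF M]
  have opn: "open ?S"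
    by (rule open_chart_preimage[OF SM \<gamma> c])
  have dom: "x s \<in> cmap c ` cdom c" if "s \<in> ?S" for s
    using that by (auto simp: x_def)
  have xt: "x t \<in> cmap c ` cdom c"
    using dom t by blast
  let ?DG = "\<lambda>u v. frechet_derivative (\<lambda>y. ?G y u v) (at (x t))"
  have dx: "(x has_vector_derivative x' t) (at t)"
    unfolding x_def x'_def by (rule smooth_curve_coord(1)[OF SM \<gamma> c t])
  have dx': "(x' has_vector_derivative x'' t) (at t)"
    unfolding x_def x'_def x''_def by (rule smooth_curve_coord(2)[OF SM \<gamma> c t])
  have dxi: "((\<lambda>s. x' s \<bullet> i) has_real_derivative x'' t \<bullet> i) (at t)" for i
    using dx' bounded_linear.has_vector_derivative[OF bounded_linear_inner_left]
    by (simp add: has_real_derivative_iff_has_vector_derivative)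
  have dG: "((\<lambda>s. ?G (x s) u v) has_real_derivative ?DG u v (x' t)) (at t)" for u v
  proof -
    have G: "((\<lambda>y. ?G y u v) has_derivative ?DG u v) (at (x t))"
      by (rule coord_metric_has_derivative[OF M c xt])
    have "((\<lambda>y. ?G y u v) \<circ> x has_derivative ?DG u v \<circ> (\<lambda>h. h *\<^sub>R x' t)) (at t)"
      using dx unfolding has_vector_derivative_def by (rule diff_chain_at) (rule G)
    then show ?thesis
      using linear_scale[OF has_derivative_linear[OF G]]
      unfolding has_real_derivative_iff_has_vector_derivative has_vector_derivative_def o_def
      by simp
  qed
  \<comment> \<open>Differentiating the basis expansion shows that the derivative of the metric is
    still bilinear in \<open>u\<close> and \<open>v\<close>; this reassembles the basis terms
    produced by the product rule below.\<close>
  have DG: "?DG u v w = (\<Sum>(i,j)\<in>?I. (u \<bullet> i) * (v \<bullet> j) * ?DG i j w)" for u v w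
  proof -
    have "((\<lambda>y. \<Sum>(i,j)\<in>?I. (u \<bullet> i) * (v \<bullet> j) * ?G y i j) has_derivative
        (\<lambda>w. \<Sum>(i,j)\<in>?I. (u \<bullet> i) * (v \<bullet> j) * ?DG i j w)) (at (x t))"
      unfolding case_prod_unfold
      by (rule has_derivative_sum) (rule has_derivative_mult_right[OF coord_metric_has_derivative[OF M c xt]])
    then have "((\<lambda>y. ?G y u v) has_derivative
        (\<lambda>w. \<Sum>(i,j)\<in>?I. (u \<bullet> i) * (v \<bullet> j) * ?DG i j w)) (at (x t))"
      by (rule has_derivative_transform_within_open[OF _ open_chart(2)[OF SM c] xt])
        (rule coord_metric_expand[OF M c, symmetric])
    from fun_cong[OF frechet_derivative_at[OF this], of w] show ?thesis
      by (rule sym)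
  qed
  have "((\<lambda>s. \<Sum>(i,j)\<in>?I. (x' s \<bullet> i) * (x' s \<bullet> j) * ?G (x s) i j) has_real_derivative
      (\<Sum>(i,j)\<in>?I. ((x'' t \<bullet> i) * (x' t \<bullet> j) + (x' t \<bullet> i) * (x'' t \<bullet> j)) * ?G (x t) i j
        + (x' t \<bullet> i) * (x' t \<bullet> j) * ?DG i j (x' t))) (at t)"
    unfolding case_prod_unfold
    by (rule DERIV_sum) (auto intro!: derivative_eq_intros dxi dG simp: algebra_simps)
  also have "(\<Sum>(i,j)\<in>?I. ((x'' t \<bullet> i) * (x' t \<bullet> j) + (x' t \<bullet> i) * (x'' t \<bullet> j)) * ?G (x t) i j
        + (x' t \<bullet> i) * (x' t \<bullet> j) * ?DG i j (x' t)) =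
      ?G (x t) (x'' t) (x' t) + ?G (x t) (x' t) (x'' t) + ?DG (x' t) (x' t) (x' t)"
    unfolding DG[of "x' t" "x' t"] coord_metric_expand[OF M c xt, of "x'' t" "x' t"]
      coord_metric_expand[OF M c xt, of "x' t" "x'' t"]
    by (simp add: sum.distrib case_prod_unfold algebra_simps)
  \<comment> \<open>With all three arguments equal to \<open>x'\<close>, two of the three terms of
    \<open>christoffel\<close> cancel and half of the derivative of the metric remains.\<close>
  also have "\<dots> = 2 * (?G (x t) (x'' t) (x' t) + christoffel M c (x t) (x' t) (x' t) (x' t))"
    by (simp add: christoffel_def coord_metric_sym[OF M, of c "x t" "x' t" "x'' t"])
  finally show ?thesis
  proof (rule has_field_derivative_transform_within_open[OF _ opn])
    fix s assume s: "s \<in> ?S"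
    then have "metric M (\<gamma> s) (velocity M \<gamma> s) (velocity M \<gamma> s) = ?G (x s) (x' s) (x' s)"
      unfolding x_def x'_def by (intro metric_velocity[OF SM \<gamma> c]) auto
    then show "(\<Sum>(i,j)\<in>?I. (x' s \<bullet> i) * (x' s \<bullet> j) * ?G (x s) i j) =
        metric M (\<gamma> s) (velocity M \<gamma> s) (velocity M \<gamma> s)"
      using coord_metric_expand[OF M c dom[OF s], of "x' s" "x' s"] by simp
  qed (use t in auto)
qed

abbreviation curve_speed ::
    "('m, 'e::euclidean_space) riem \<Rightarrow> (real \<Rightarrow> 'm) \<Rightarrow> real \<Rightarrow> real" where
  "curve_speed M \<gamma> t \<equiv> tnorm M (\<gamma> t) (velocity M \<gamma> t)"

text \<open>Only the squared speed is differentiable in general; continuity survives the square root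
  also where the velocity vanishes.\<close>

lemma curve_speed_continuous:
  assumes M: "riemannian_manifold M" and \<gamma>: "smooth_curve M J \<gamma>" and t: "t \<in> J"
  shows "isCont (curve_speed M \<gamma>) t"
proof -
  have "isCont (\<lambda>s. metric M (\<gamma> s) (velocity M \<gamma> s) (velocity M \<gamma> s)) t"
    using speed_squared_has_derivative[OF M \<gamma> _ t] chart_at_atlas[OF riemannian_smooth[OF M], of "\<gamma> t"]
    by (blast intro: DERIV_isCont)
  then show ?thesis
    unfolding tnorm_def by (intro continuous_intros)
qed

text \<open>The geodesic equation with \<open>w = x'\<close> makes the derivative of the squared
  speed vanish. Each parameter is treated in the chart preferred at its own point, so no chart has
  to contain the whole curve.\<close>

lemma geodesic_constant_speed:
  assumes M: "riemannian_manifold M" and \<gamma>: "geodesic M J \<gamma>" and "{a..b} \<subseteq> J"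
    and "s \<in> {a..b}" and "t \<in> {a..b}"
  shows "curve_speed M \<gamma> s = curve_speed M \<gamma> t"
proof -
  have sm: "smooth_curve M J \<gamma>"
    using \<gamma> by (simp add: geodesic_def)
  have "\<exists>k. \<forall>u\<in>{a..b}. metric M (\<gamma> u) (velocity M \<gamma> u) (velocity M \<gamma> u) = k"
  proof (rule has_field_derivative_zero_constant)
    fix u assume "u \<in> {a..b}"
    then have u: "u \<in> J"
      using assms(3) by blast
    let ?c = "chart_at M (\<gamma> u)"
    let ?x' = "\<lambda>s. vector_derivative (cmap ?c \<circ> \<gamma>) (at s)"
    let ?x'' = "\<lambda>s. vector_derivative ?x' (at s)"
    note c = chart_at_atlas[OF riemannian_smooth[OF M], of "\<gamma> u"]
    have "coord_metric M ?c ((cmap ?c \<circ> \<gamma>) u) (?x'' u) (?x' u)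
        + christoffel M ?c ((cmap ?c \<circ> \<gamma>) u) (?x' u) (?x' u) (?x' u) = 0"
      using \<gamma> c u unfolding geodesic_def Let_def by blast
    then show "((\<lambda>u. metric M (\<gamma> u) (velocity M \<gamma> u) (velocity M \<gamma> u)) has_field_derivative 0)
        (at u within {a..b})"
      using speed_squared_has_derivative[OF M sm c(1) u c(2)]
      by (simp add: has_field_derivative_at_within)
  qed simp
  then show ?thesis
    using assms(4,5) by (metis tnorm_def)
qed

lemma geodesic_curve_length:
  assumes M: "riemannian_manifold M" and \<gamma>: "geodesic M J \<gamma>" and "{0..1} \<subseteq> J"
  shows "curve_length M \<gamma> 0 1 = curve_speed M \<gamma> 0"
proof -
  have "curve_length M \<gamma> 0 1 = integral {0..1::real} (\<lambda>t. curve_speed M \<gamma> 0)"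
    unfolding curve_length_def
    by (intro Henstock_Kurzweil_Integration.integral_cong geodesic_constant_speed[OF assms]) auto
  then show ?thesis by simp
qed

section \<open>Curves of speed at most one\<close>

lemma smooth_curve_restrict:
  assumes "smooth_manifold M" and \<sigma>: "smooth_curve M J \<sigma>" and U: "open U" "U \<subseteq> J" and eq: "\<And>u. u \<in> U \<Longrightarrow> \<sigma> u = \<gamma> u"
  shows "smooth_curve M U \<gamma>"
  unfolding smooth_curve_def
proof (intro conjI ballI)
  show "continuous_on U \<gamma>"
    using \<sigma> U eq unfolding smooth_curve_def by (metis continuous_on_cong continuous_on_subset)
next
  fix c assume c: "c \<in> atlas M"
  have eqS: "U \<inter> \<gamma> -` cdom c = U \<inter> (J \<inter> \<sigma> -` cdom c)"
    using U(2) eq by auto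
  have "open (U \<inter> (J \<inter> \<sigma> -` cdom c))"
    using U(1) open_chart_preimage[OF assms(1,2) c] by blast
  moreover have "smooth_on (U \<inter> (J \<inter> \<sigma> -` cdom c)) (cmap c \<circ> \<sigma>)"
    using \<sigma> c unfolding smooth_curve_def by (blast intro: smooth_on_subset)
  ultimately show "smooth_on (U \<inter> \<gamma> -` cdom c) (cmap c \<circ> \<gamma>)"
    unfolding eqS using eq by (auto intro: smooth_on_cong)
qed (rule U)

lemma velocity_cong:
  assumes "open U" and "t \<in> U" and eq: "\<And>u. u \<in> U \<Longrightarrow> \<sigma> u = \<gamma> u"
  shows "velocity M \<sigma> t = velocity M \<gamma> t"
proof -
  let ?c = "chart_at M (\<gamma> t)"
  have "((cmap ?c \<circ> \<sigma>) has_vector_derivative v) (at t) \<longleftrightarrow>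
      ((cmap ?c \<circ> \<gamma>) has_vector_derivative v) (at t)" for v
    using has_vector_derivative_transform_within_open[OF _ assms(1,2), of "cmap ?c \<circ> \<sigma>" v "cmap ?c \<circ> \<gamma>"]
      has_vector_derivative_transform_within_open[OF _ assms(1,2), of "cmap ?c \<circ> \<gamma>" v "cmap ?c \<circ> \<sigma>"]
    by (auto simp: eq)
  then show ?thesis
    using eq[OF assms(2)] by (simp add: velocity_def vector_derivative_def)
qed

lemma smooth_curve_affine:
  assumes "smooth_manifold M" and \<gamma>: "smooth_curve M J \<gamma>"
  shows "smooth_curve M ((\<lambda>t. k * t + d) -` J) (\<lambda>t. \<gamma> (k * t + d))"
  unfolding smooth_curve_def
proof (intro conjI ballI)
  show "open ((\<lambda>t. k * t + d) -` J)"
    using \<gamma> unfolding smooth_curve_def by (intro open_vimage continuous_intros) auto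
  show "continuous_on ((\<lambda>t. k * t + d) -` J) (\<lambda>t. \<gamma> (k * t + d))"
    using \<gamma> unfolding smooth_curve_def
    by (intro continuous_on_compose2[of J \<gamma> _ "\<lambda>t. k * t + d"]) (auto intro!: continuous_intros)
next
  fix c assume c: "c \<in> atlas M"
  have eq: "(\<lambda>t. k * t + d) -` J \<inter> (\<lambda>t. \<gamma> (k * t + d)) -` cdom c =
      (\<lambda>t. k * t + d) -` (J \<inter> \<gamma> -` cdom c)"
    by auto
  have "smooth_on (J \<inter> \<gamma> -` cdom c) (cmap c \<circ> \<gamma>)"
    using \<gamma> c unfolding smooth_curve_def by blast
  then show "smooth_on ((\<lambda>t. k * t + d) -` J \<inter> (\<lambda>t. \<gamma> (k * t + d)) -` cdom c)
      (cmap c \<circ> (\<lambda>t. \<gamma> (k * t + d)))"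
    unfolding eq smooth_on_def
    using Ck_on_affine[OF _ open_chart_preimage[OF assms c], of _ "cmap c \<circ> \<gamma>"]
    by (simp add: o_def)
qed

lemma smooth_curve_has_velocity:
  assumes "smooth_manifold M" and "smooth_curve M J \<gamma>" and "t \<in> J"
  shows "((cmap (chart_at M (\<gamma> t)) \<circ> \<gamma>) has_vector_derivative velocity M \<gamma> t) (at t)"
  unfolding velocity_def
  by (rule smooth_curve_coord(1)[OF assms(1,2) chart_at_atlas(1)[OF assms(1)] assms(3)])
    (rule chart_at_atlas(2)[OF assms(1)])

lemma velocity_affine:
  assumes "smooth_manifold M" and "smooth_curve M J \<gamma>" and "k * t + d \<in> J"
  shows "velocity M (\<lambda>t. \<gamma> (k * t + d)) t = k *\<^sub>R velocity M \<gamma> (k * t + d)"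
proof -
  let ?c = "chart_at M (\<gamma> (k * t + d))"
  have "((\<lambda>t. k * t + d) has_vector_derivative k) (at t)"
    by (auto intro!: derivative_eq_intros simp: has_vector_derivative_def)
  from vector_diff_chain_at[OF this smooth_curve_has_velocity[OF assms]]
  show ?thesis
    unfolding velocity_def by (intro vector_derivative_at) (simp add: o_def velocity_def)
qed

lemma tnorm_scaleR:
  "riemannian_manifold M \<Longrightarrow> tnorm M p (k *\<^sub>R v) = \<bar>k\<bar> * tnorm M p v"
  using bilinear_metric[of M p]
  by (simp add: tnorm_def bilinear_lmul bilinear_rmul real_sqrt_mult)

lemma tnorm_nonneg: "riemannian_manifold M \<Longrightarrow> 0 \<le> tnorm M p v"
  by (simp add: tnorm_def metric_nonneg)

lemma piecewise_smooth_affine: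
  assumes "smooth_manifold M" and \<gamma>: "piecewise_smooth_curve M \<gamma> (k * a + d) (k * b + d)" and "0 < k"
  shows "piecewise_smooth_curve M (\<lambda>t. \<gamma> (k * t + d)) a b"
proof -
  obtain T where T: "finite T" and piece: "\<And>s t. k * a + d \<le> s \<Longrightarrow> s < t \<Longrightarrow> t \<le> k * b + d \<Longrightarrow>
      {s<..<t} \<inter> T = {} \<Longrightarrow>
      \<exists>J \<sigma>. smooth_curve M J \<sigma> \<and> {s..t} \<subseteq> J \<and> (\<forall>u\<in>{s..t}. \<sigma> u = \<gamma> u)"
    using \<gamma> unfolding piecewise_smooth_curve_def by blast
  show ?thesis
    unfolding piecewise_smooth_curve_def
  proof (rule exI, intro conjI allI impI)
    have "inj (\<lambda>t. k * t + d)"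
      using \<open>0 < k\<close> by (auto intro: injI)
    then show "finite ((\<lambda>t. k * t + d) -` T)"
      using T by (rule finite_vimageI[rotated])
  next
    fix s t assume st: "a \<le> s \<and> s < t \<and> t \<le> b \<and> {s<..<t} \<inter> (\<lambda>t. k * t + d) -` T = {}"
    have "{k * s + d<..<k * t + d} \<inter> T = {}"
    proof (rule ccontr)
      assume "{k * s + d<..<k * t + d} \<inter> T \<noteq> {}"
      then obtain u where u: "k * s + d < u" "u < k * t + d" "u \<in> T"
        by auto
      then have "(u - d) / k \<in> {s<..<t}" "(u - d) / k \<in> (\<lambda>t. k * t + d) -` T"
        using \<open>0 < k\<close> by (auto simp: field_simps)
      then show False
        using st by blast
    qed
    moreover have "k * a + d \<le> k * s + d" "k * s + d < k * t + d" "k * t + d \<le> k * b + d"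
      using st \<open>0 < k\<close> by auto
    ultimately obtain J \<sigma> where J: "smooth_curve M J \<sigma>" "{k * s + d..k * t + d} \<subseteq> J"
      and \<sigma>: "\<forall>u\<in>{k * s + d..k * t + d}. \<sigma> u = \<gamma> u"
      using piece by meson
    have mem: "k * u + d \<in> {k * s + d..k * t + d}" if "u \<in> {s..t}" for u
      using that \<open>0 < k\<close> by auto
    show "\<exists>J' \<sigma>'. smooth_curve M J' \<sigma>' \<and> {s..t} \<subseteq> J' \<and> (\<forall>u\<in>{s..t}. \<sigma>' u = \<gamma> (k * u + d))"
    proof (intro exI conjI)
      show "smooth_curve M ((\<lambda>t. k * t + d) -` J) (\<lambda>t. \<sigma> (k * t + d))"
        by (rule smooth_curve_affine[OF assms(1) J(1)])
      show "{s..t} \<subseteq> (\<lambda>t. k * t + d) -` J"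
        using mem J(2) by blast
      show "\<forall>u\<in>{s..t}. \<sigma> (k * u + d) = \<gamma> (k * u + d)"
        using mem \<sigma> by blast
    qed
  qed
qed

text \<open>The exceptional set is independent of the break points in
  \<open>piecewise_smooth_curve\<close>. Demanding a smooth curve around every other parameter makes
  \<open>velocity\<close> a genuine derivative there, whereas \<open>vector_derivative\<close> has
  an arbitrary value where the curve is not differentiable.\<close>

definition speed_bounded ::
    "('m::topological_space, 'e::euclidean_space) riem \<Rightarrow> (real \<Rightarrow> 'm) \<Rightarrow> real \<Rightarrow> real \<Rightarrow> real \<Rightarrow> bool" where
  "speed_bounded M \<gamma> a b k \<longleftrightarrow>
     (\<exists>T. finite T \<and> (\<forall>t\<in>{a<..<b} - T. (\<exists>U. t \<in> U \<and> smooth_curve M U \<gamma>) \<and> curve_speed M \<gamma> t \<le> k))"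

lemma speed_bounded_affine:
  assumes M: "riemannian_manifold M" and "speed_bounded M \<gamma> (k * a + d) (k * b + d) l" and "0 < k"
  shows "speed_bounded M (\<lambda>t. \<gamma> (k * t + d)) a b (k * l)"
proof -
  note SM = riemannian_smooth[OF M]
  obtain T where T: "finite T" "\<And>t. t \<in> {k * a + d<..<k * b + d} \<Longrightarrow> t \<notin> T \<Longrightarrow>
      (\<exists>U. t \<in> U \<and> smooth_curve M U \<gamma>) \<and> curve_speed M \<gamma> t \<le> l"
    using assms(2) unfolding speed_bounded_def by blast
  have "inj (\<lambda>t. k * t + d)"
    using \<open>0 < k\<close> by (auto intro: injI)
  with T(1) have "finite ((\<lambda>t. k * t + d) -` T)"
    by (rule finite_vimageI)
  moreover have "(\<exists>U. t \<in> U \<and> smooth_curve M U (\<lambda>t. \<gamma> (k * t + d))) \<and>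
      curve_speed M (\<lambda>t. \<gamma> (k * t + d)) t \<le> k * l"
    if t: "t \<in> {a<..<b} - (\<lambda>t. k * t + d) -` T" for t
  proof -
    have "k * t + d \<in> {k * a + d<..<k * b + d}" "k * t + d \<notin> T"
      using t \<open>0 < k\<close> by auto
    from T(2)[OF this] obtain U where U: "k * t + d \<in> U" "smooth_curve M U \<gamma>"
      and le: "curve_speed M \<gamma> (k * t + d) \<le> l"
      by blast
    have "curve_speed M (\<lambda>t. \<gamma> (k * t + d)) t = k * curve_speed M \<gamma> (k * t + d)"
      using \<open>0 < k\<close> by (simp add: velocity_affine[OF SM U(2,1)] tnorm_scaleR[OF M])
    then show ?thesis
      using smooth_curve_affine[OF SM U(2), of k d] U(1) le \<open>0 < k\<close>
      by (auto intro!: exI[of _ "(\<lambda>t. k * t + d) -` U"])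
  qed
  ultimately show ?thesis
    unfolding speed_bounded_def by blast
qed

text \<open>
  A smooth curve need not have a smooth parametrization by arc length, since its velocity may
  vanish. Rescaling the parameter by a constant on each of finitely many short arcs loses only an
  arbitrarily small amount of length, keeps the curve piecewise smooth and bounds its speed by one.
  Two curves of bounded speed then combine to a short curve in the product.
\<close>

definition reachable :: "('m::topological_space, 'e::euclidean_space) riem \<Rightarrow> 'm \<Rightarrow> 'm \<Rightarrow> real \<Rightarrow> bool" where
  "reachable M p q l \<longleftrightarrow> 0 \<le> l \<and>
     (\<exists>\<gamma>. piecewise_smooth_curve M \<gamma> 0 l \<and> \<gamma> 0 = p \<and> \<gamma> l = q \<and> speed_bounded M \<gamma> 0 l 1)"

section \<open>Concatenation of curves of speed at most one\<close>

lemma reachable_refl: "reachable M p p 0"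
  unfolding reachable_def piecewise_smooth_curve_def speed_bounded_def
  by (intro conjI exI[of _ "\<lambda>_. p"] exI[of _ "{}"]) auto

lemma piecewise_smooth_join:
  assumes "piecewise_smooth_curve M \<gamma>\<^sub>1 a b" and "piecewise_smooth_curve M \<gamma>\<^sub>2 b c" and "\<gamma>\<^sub>1 b = \<gamma>\<^sub>2 b"
  shows "piecewise_smooth_curve M (\<lambda>t. if t \<le> b then \<gamma>\<^sub>1 t else \<gamma>\<^sub>2 t) a c"
proof -
  obtain T\<^sub>1 where T\<^sub>1: "finite T\<^sub>1" "\<And>s t. a \<le> s \<Longrightarrow> s < t \<Longrightarrow> t \<le> b \<Longrightarrow> {s<..<t} \<inter> T\<^sub>1 = {} \<Longrightarrow>
      \<exists>J \<sigma>. smooth_curve M J \<sigma> \<and> {s..t} \<subseteq> J \<and> (\<forall>u\<in>{s..t}. \<sigma> u = \<gamma>\<^sub>1 u)"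
    using assms(1) unfolding piecewise_smooth_curve_def by blast
  obtain T\<^sub>2 where T\<^sub>2: "finite T\<^sub>2" "\<And>s t. b \<le> s \<Longrightarrow> s < t \<Longrightarrow> t \<le> c \<Longrightarrow> {s<..<t} \<inter> T\<^sub>2 = {} \<Longrightarrow>
      \<exists>J \<sigma>. smooth_curve M J \<sigma> \<and> {s..t} \<subseteq> J \<and> (\<forall>u\<in>{s..t}. \<sigma> u = \<gamma>\<^sub>2 u)"
    using assms(2) unfolding piecewise_smooth_curve_def by blast
  show ?thesis
    unfolding piecewise_smooth_curve_def
  proof (rule exI, intro conjI allI impI)
    \<comment> \<open>With the junction \<open>b\<close> among the break points, every interval that
      avoids them lies entirely on one side of \<open>b\<close>.\<close>
    show "finite (insert b (T\<^sub>1 \<union> T\<^sub>2))"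
      using T\<^sub>1(1) T\<^sub>2(1) by simp
  next
    fix s t assume st: "a \<le> s \<and> s < t \<and> t \<le> c \<and> {s<..<t} \<inter> insert b (T\<^sub>1 \<union> T\<^sub>2) = {}"
    then have st': "s < t" "{s<..<t} \<inter> T\<^sub>1 = {}" "{s<..<t} \<inter> T\<^sub>2 = {}" "b \<notin> {s<..<t}"
      by blast+
    then consider "t \<le> b" | "b \<le> s"
      by fastforce
    then show "\<exists>J \<sigma>. smooth_curve M J \<sigma> \<and> {s..t} \<subseteq> J \<and>
        (\<forall>u\<in>{s..t}. \<sigma> u = (if u \<le> b then \<gamma>\<^sub>1 u else \<gamma>\<^sub>2 u))"
    proof cases
      case 1
      have "a \<le> s"
        using st by blast
      with 1 obtain J \<sigma> where "smooth_curve M J \<sigma>" "{s..t} \<subseteq> J" "\<forall>u\<in>{s..t}. \<sigma> u = \<gamma>\<^sub>1 u"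
        using T\<^sub>1(2) st' by meson
      with 1 show ?thesis
        by (intro exI[of _ J] exI[of _ \<sigma>]) auto
    next
      case 2
      have "t \<le> c"
        using st by blast
      with 2 obtain J \<sigma> where "smooth_curve M J \<sigma>" "{s..t} \<subseteq> J" "\<forall>u\<in>{s..t}. \<sigma> u = \<gamma>\<^sub>2 u"
        using T\<^sub>2(2) st' by meson
      moreover have "(if u \<le> b then \<gamma>\<^sub>1 u else \<gamma>\<^sub>2 u) = \<gamma>\<^sub>2 u" if "u \<in> {s..t}" for u
        using that 2 assms(3) by (cases "u = b") auto
      ultimately show ?thesis
        by (intro exI[of _ J] exI[of _ \<sigma>]) auto
    qed
  qed
qed

text \<open>Agreement on the open interval suffices because the bound says nothing about the
  endpoints. A concatenation thus inherits the bounds of its parts even though it has a corner at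
  the junction.\<close>

lemma speed_bounded_cong:
  assumes "smooth_manifold M" and "speed_bounded M \<gamma> a b k" and eq: "\<And>t. t \<in> {a<..<b} \<Longrightarrow> \<gamma> t = \<sigma> t"
  shows "speed_bounded M \<sigma> a b k"
proof -
  obtain T where T: "finite T" "\<And>t. t \<in> {a<..<b} - T \<Longrightarrow>
      (\<exists>U. t \<in> U \<and> smooth_curve M U \<gamma>) \<and> curve_speed M \<gamma> t \<le> k"
    using assms(2) unfolding speed_bounded_def by blast
  have "(\<exists>U. t \<in> U \<and> smooth_curve M U \<sigma>) \<and> curve_speed M \<sigma> t \<le> k" if t: "t \<in> {a<..<b} - T" for t
  proof -
    from T(2)[OF t] obtain U where U: "t \<in> U" "smooth_curve M U \<gamma>" and le: "curve_speed M \<gamma> t \<le> k"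
      by blast
    have "open U"
      using U(2) by (simp add: smooth_curve_def)
    then have "smooth_curve M (U \<inter> {a<..<b}) \<sigma>"
      by (intro smooth_curve_restrict[OF assms(1) U(2)]) (auto simp: eq)
    moreover have "curve_speed M \<sigma> t = curve_speed M \<gamma> t"
      using velocity_cong[of "{a<..<b}" t \<gamma> \<sigma> M] eq t by auto
    moreover have "t \<in> U \<inter> {a<..<b}"
      using U(1) t by blast
    ultimately show ?thesis
      using le by metis
  qed
  with T(1) show ?thesis
    unfolding speed_bounded_def by blast
qed

lemma speed_bounded_union:
  assumes "speed_bounded M \<gamma> a b k" and "speed_bounded M \<gamma> b c k"
  shows "speed_bounded M \<gamma> a c k"
proof -
  obtain T where T: "finite T" "\<And>t. t \<in> {a<..<b} - T \<Longrightarrow>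
      (\<exists>U. t \<in> U \<and> smooth_curve M U \<gamma>) \<and> curve_speed M \<gamma> t \<le> k"
    using assms(1) unfolding speed_bounded_def by blast
  obtain T' where T': "finite T'" "\<And>t. t \<in> {b<..<c} - T' \<Longrightarrow>
      (\<exists>U. t \<in> U \<and> smooth_curve M U \<gamma>) \<and> curve_speed M \<gamma> t \<le> k"
    using assms(2) unfolding speed_bounded_def by blast
  have "(\<exists>U. t \<in> U \<and> smooth_curve M U \<gamma>) \<and> curve_speed M \<gamma> t \<le> k"
    if "t \<in> {a<..<c} - insert b (T \<union> T')" for t
    using T(2)[of t] T'(2)[of t] that by (cases "t < b") auto
  moreover have "finite (insert b (T \<union> T'))"
    using T(1) T'(1) by simp
  ultimately show ?thesis
    unfolding speed_bounded_def by blast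
qed

lemma reachable_trans:
  assumes M: "riemannian_manifold M" and "reachable M p q l" and "reachable M q r l'"
  shows "reachable M p r (l + l')"
proof -
  note SM = riemannian_smooth[OF M]
  obtain \<gamma> where l: "0 \<le> l" and \<gamma>: "piecewise_smooth_curve M \<gamma> 0 l" "\<gamma> 0 = p" "\<gamma> l = q" "speed_bounded M \<gamma> 0 l 1"
    using assms(2) unfolding reachable_def by blast
  obtain \<sigma> where l': "0 \<le> l'" and \<sigma>: "piecewise_smooth_curve M \<sigma> 0 l'" "\<sigma> 0 = q" "\<sigma> l' = r" "speed_bounded M \<sigma> 0 l' 1"
    using assms(3) unfolding reachable_def by blast
  \<comment> \<open>The shift by \<open>l\<close> is written in the form \<open>k * t + d\<close> of
    the affine lemmas.\<close>
  define \<tau> where "\<tau> = (\<lambda>t. \<sigma> (1 * t + - l))"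
  have \<tau>: "piecewise_smooth_curve M \<tau> l (l + l')" "speed_bounded M \<tau> l (l + l') (1 * 1)"
    unfolding \<tau>_def using \<sigma>
    by (intro piecewise_smooth_affine[OF SM] speed_bounded_affine[OF M]; simp)+
  let ?\<rho> = "\<lambda>t. if t \<le> l then \<gamma> t else \<tau> t"
  have "piecewise_smooth_curve M ?\<rho> 0 (l + l')"
    using \<gamma> \<sigma> by (intro piecewise_smooth_join \<tau>) (auto simp: \<tau>_def)
  moreover have "speed_bounded M ?\<rho> 0 (l + l') 1"
  proof (rule speed_bounded_union)
    show "speed_bounded M ?\<rho> 0 l 1"
      by (rule speed_bounded_cong[OF SM \<gamma>(4)]) auto
    show "speed_bounded M ?\<rho> l (l + l') 1"
      by (rule speed_bounded_cong[OF SM \<tau>(2)[simplified]]) auto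
  qed
  moreover have "?\<rho> 0 = p" "?\<rho> (l + l') = r"
    using \<gamma> \<sigma> l l' by (auto simp: \<tau>_def)
  ultimately show ?thesis
    using l l' unfolding reachable_def by (intro conjI exI[of _ ?\<rho>]) auto
qed

text \<open>Dividing the parameter rate by the upper bound \<open>k\<close> of the speed makes the
  speed at most one, at the price of a running time that exceeds the length unless the speed is
  constantly \<open>k\<close>. On a short arc this excess is small.\<close>

lemma reachable_smooth_curve:
  assumes M: "riemannian_manifold M" and \<sigma>: "smooth_curve M J \<sigma>" and "u \<le> v" and J: "{u..v} \<subseteq> J"
    and "0 < k" and le: "\<And>t. t \<in> {u..v} \<Longrightarrow> curve_speed M \<sigma> t \<le> k"
  shows "reachable M (\<sigma> u) (\<sigma> v) (k * (v - u))"
proof -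
  note SM = riemannian_smooth[OF M]
  define \<tau> where "\<tau> = (\<lambda>t. \<sigma> (1 / k * t + u))"
  have ends: "1 / k * 0 + u = u" "1 / k * (k * (v - u)) + u = v"
    using \<open>0 < k\<close> by auto
  have "piecewise_smooth_curve M \<sigma> u v"
    unfolding piecewise_smooth_curve_def using \<sigma> J
    by (intro exI[of _ "{}"] conjI allI impI exI[of _ J] exI[of _ \<sigma>]) auto
  then have "piecewise_smooth_curve M \<tau> 0 (k * (v - u))"
    unfolding \<tau>_def using \<open>0 < k\<close> by (intro piecewise_smooth_affine[OF SM]) (simp_all add: ends)
  moreover have "speed_bounded M \<sigma> u v k"
    unfolding speed_bounded_def
  proof (rule exI[of _ "{}"], intro conjI ballI)
    fix t assume "t \<in> {u<..<v} - {}"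
    then have t: "t \<in> {u..v}"
      by simp
    then show "\<exists>U. t \<in> U \<and> smooth_curve M U \<sigma>"
      using \<sigma> J by blast
    show "curve_speed M \<sigma> t \<le> k"
      by (rule le[OF t])
  qed simp
  then have "speed_bounded M \<tau> 0 (k * (v - u)) (1 / k * k)"
    unfolding \<tau>_def using \<open>0 < k\<close> by (intro speed_bounded_affine[OF M]) (simp_all only: ends, simp)
  ultimately show ?thesis
    unfolding reachable_def using \<open>0 < k\<close> \<open>u \<le> v\<close>
    by (intro conjI exI[of _ \<tau>]) (auto simp: \<tau>_def)
qed

section \<open>Approximating the length of a piecewise smooth curve by running times\<close>

lemma curve_speed_local:
  assumes M: "riemannian_manifold M" and \<sigma>: "smooth_curve M J \<sigma>" and "u \<le> v" and J: "{u..v} \<subseteq> J"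
    and eq: "\<And>t. t \<in> {u..v} \<Longrightarrow> \<sigma> t = \<gamma> t"
  shows "curve_speed M \<gamma> integrable_on {u..v}"
    and "integral {u..v} (curve_speed M \<gamma>) = integral {u..v} (curve_speed M \<sigma>)"
    and "curve_speed M \<sigma> integrable_on {u..v}"
proof -
  \<comment> \<open>At the ends of the interval the velocity of \<open>\<gamma>\<close> also depends
    on \<open>\<gamma>\<close> outside it, so the speeds are compared in the interior only; two
    points do not affect an integral.\<close>
  have agree: "curve_speed M \<sigma> t = curve_speed M \<gamma> t" if "t \<in> {u..v} - {u, v}" for t
  proof -
    have "t \<in> {u<..<v}"
      using that by auto
    then have "velocity M \<sigma> t = velocity M \<gamma> t" "\<sigma> t = \<gamma> t"
      by (auto intro!: velocity_cong[of "{u<..<v}"] eq)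
    then show ?thesis by simp
  qed
  have "continuous_on {u..v} (curve_speed M \<sigma>)"
    using curve_speed_continuous[OF M \<sigma>] J by (intro continuous_at_imp_continuous_on) auto
  then show int: "curve_speed M \<sigma> integrable_on {u..v}"
    by (rule integrable_continuous_interval)
  show "curve_speed M \<gamma> integrable_on {u..v}"
    using int by (rule integrable_spike_finite[of "{u, v}", rotated -1]) (use agree in auto)
  show "integral {u..v} (curve_speed M \<gamma>) = integral {u..v} (curve_speed M \<sigma>)"
    by (rule integral_spike[of "{u, v}"]) (use agree in auto)
qed

text \<open>The error is proportional to \<open>v - u\<close>, so that the errors of adjacent
  intervals add up to the same rate however many there are. Integrability is included because
  lengths add only for integrable speeds. The time \<open>l\<close> is kept positive, even for a
  constant curve, since it later serves as a scaling factor.\<close>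

definition nearly_reached ::
    "('m::topological_space, 'e::euclidean_space) riem \<Rightarrow> (real \<Rightarrow> 'm) \<Rightarrow> real \<Rightarrow> real \<Rightarrow> real \<Rightarrow> bool" where
  "nearly_reached M \<gamma> \<delta> u v \<longleftrightarrow> curve_speed M \<gamma> integrable_on {u..v} \<and>
     (\<exists>l. reachable M (\<gamma> u) (\<gamma> v) l \<and> (u < v \<longrightarrow> 0 < l) \<and> l \<le> curve_length M \<gamma> u v + \<delta> * (v - u))"

lemma nearly_reached_trans:
  assumes M: "riemannian_manifold M" and "nearly_reached M \<gamma> \<delta> u v" and "nearly_reached M \<gamma> \<delta> v w"
    and "u \<le> v" and "v \<le> w"
  shows "nearly_reached M \<gamma> \<delta> u w"
proof -
  obtain l where l: "curve_speed M \<gamma> integrable_on {u..v}" "reachable M (\<gamma> u) (\<gamma> v) l"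
      "u < v \<longrightarrow> 0 < l" "l \<le> curve_length M \<gamma> u v + \<delta> * (v - u)"
    using assms(2) unfolding nearly_reached_def by blast
  obtain l' where l': "curve_speed M \<gamma> integrable_on {v..w}" "reachable M (\<gamma> v) (\<gamma> w) l'"
      "v < w \<longrightarrow> 0 < l'" "l' \<le> curve_length M \<gamma> v w + \<delta> * (w - v)"
    using assms(3) unfolding nearly_reached_def by blast
  have int: "curve_speed M \<gamma> integrable_on {u..w}"
    by (rule Henstock_Kurzweil_Integration.integrable_combine[OF assms(4,5) l(1) l'(1)])
  have "curve_length M \<gamma> u v + curve_length M \<gamma> v w = curve_length M \<gamma> u w"
    unfolding curve_length_def
    by (rule Henstock_Kurzweil_Integration.integral_combine[OF assms(4,5) int])
  then have "l + l' \<le> curve_length M \<gamma> u w + \<delta> * (w - u)"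
    using l(4) l'(4) by (simp add: algebra_simps)
  moreover have "u < w \<longrightarrow> 0 < l + l'"
    using l(2,3) l'(2,3) unfolding reachable_def by linarith
  ultimately show ?thesis
    using reachable_trans[OF M l(2) l'(2)] int unfolding nearly_reached_def by blast
qed

text \<open>Near \<open>x\<close> the speed stays within \<delta>/2 of its value s at
  \<open>x\<close>. Running at the bound s + \<delta>/2 takes the time (s + \<delta>/2)(v - u),
  while the length is at least (s - \<delta>/2)(v - u), so the excess is at most \<delta>(v -
  u).\<close>

lemma nearly_reached_near:
  assumes M: "riemannian_manifold M" and \<sigma>: "smooth_curve M J \<sigma>" and x: "x \<in> J" and "0 < \<delta>"
  obtains d where "0 < d" and "\<And>u v. u \<le> v \<Longrightarrow> {u..v} \<subseteq> {x - d<..<x + d} \<Longrightarrow>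
    (\<And>t. t \<in> {u..v} \<Longrightarrow> \<sigma> t = \<gamma> t) \<Longrightarrow> nearly_reached M \<gamma> \<delta> u v"
proof -
  let ?s = "curve_speed M \<sigma>"
  obtain d\<^sub>1 where d\<^sub>1: "0 < d\<^sub>1" "\<And>t. \<bar>t - x\<bar> < d\<^sub>1 \<Longrightarrow> \<bar>?s t - ?s x\<bar> < \<delta> / 2"
    using curve_speed_continuous[OF M \<sigma> x] \<open>0 < \<delta>\<close> unfolding continuous_at_eps_delta dist_real_def
    by (metis half_gt_zero)
  obtain d\<^sub>2 where d\<^sub>2: "0 < d\<^sub>2" "ball x d\<^sub>2 \<subseteq> J"
    using \<sigma> x unfolding smooth_curve_def by (meson open_contains_ball)
  show thesis
  proof
    show "0 < min d\<^sub>1 d\<^sub>2"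
      using d\<^sub>1 d\<^sub>2 by simp
  next
    fix u v assume uv: "u \<le> v" "{u..v} \<subseteq> {x - min d\<^sub>1 d\<^sub>2<..<x + min d\<^sub>1 d\<^sub>2}"
      and eq: "\<And>t. t \<in> {u..v} \<Longrightarrow> \<sigma> t = \<gamma> t"
    have near: "\<bar>t - x\<bar> < d\<^sub>1" "\<bar>t - x\<bar> < d\<^sub>2" if "t \<in> {u..v}" for t
    proof -
      have "t \<in> {x - min d\<^sub>1 d\<^sub>2<..<x + min d\<^sub>1 d\<^sub>2}"
        using uv(2) that by blast
      then show "\<bar>t - x\<bar> < d\<^sub>1" "\<bar>t - x\<bar> < d\<^sub>2"
        by auto
    qed
    have J: "{u..v} \<subseteq> J"
      using near(2) d\<^sub>2(2) by (auto simp: subset_iff dist_real_def abs_minus_commute)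
    note loc = curve_speed_local[OF M \<sigma> uv(1) J, of \<gamma>, OF eq]
    have bd: "?s x - \<delta> / 2 \<le> ?s t" "?s t \<le> ?s x + \<delta> / 2" if "t \<in> {u..v}" for t
      using d\<^sub>1(2)[OF near(1)[OF that]] by linarith+
    \<comment> \<open>The summand \<delta>/2 keeps the rate positive also where the velocity of
      \<open>\<sigma>\<close> vanishes.\<close>
    have "0 < ?s x + \<delta> / 2"
      using tnorm_nonneg[OF M, of "\<sigma> x" "velocity M \<sigma> x"] \<open>0 < \<delta>\<close> by linarith
    then have "u < v \<longrightarrow> 0 < (?s x + \<delta> / 2) * (v - u)"
      and "reachable M (\<sigma> u) (\<sigma> v) ((?s x + \<delta> / 2) * (v - u))"
      using bd(2) by (simp, intro reachable_smooth_curve[OF M \<sigma> uv(1) J])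
    moreover have "integral {u..v} (\<lambda>t. ?s x - \<delta> / 2) \<le> integral {u..v} ?s"
      using loc bd(1) by (intro integral_le) auto
    then have "(?s x - \<delta> / 2) * (v - u) \<le> integral {u..v} ?s"
      using uv(1) by (simp add: mult.commute)
    then have "(?s x + \<delta> / 2) * (v - u) \<le> curve_length M \<gamma> u v + \<delta> * (v - u)"
      using loc(2) unfolding curve_length_def by (simp add: field_simps)
    ultimately show "nearly_reached M \<gamma> \<delta> u v"
      unfolding nearly_reached_def using loc(1) eq[of u] eq[of v] uv(1) by auto
  qed
qed

text \<open>Bisection: the property passes to unions of adjacent intervals, so it is enough to have
  it on all small intervals around each point. At a break point the smooth arcs on the two sides
  differ, hence the one-sided claims \<open>right\<close> and \<open>left\<close>, which are
  combined by splitting the interval at \<open>x\<close>.\<close>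

lemma piecewise_smooth_nearly_reached:
  assumes M: "riemannian_manifold M" and \<gamma>: "piecewise_smooth_curve M \<gamma> a b" and "a \<le> b" and "0 < \<delta>"
  shows "nearly_reached M \<gamma> \<delta> a b"
proof -
  obtain T where T: "finite T" and piece: "\<And>s t. a \<le> s \<Longrightarrow> s < t \<Longrightarrow> t \<le> b \<Longrightarrow> {s<..<t} \<inter> T = {} \<Longrightarrow>
      \<exists>J \<sigma>. smooth_curve M J \<sigma> \<and> {s..t} \<subseteq> J \<and> (\<forall>u\<in>{s..t}. \<sigma> u = \<gamma> u)"
    using \<gamma> unfolding piecewise_smooth_curve_def by blast
  have refl: "nearly_reached M \<gamma> \<delta> x x" for x
    unfolding nearly_reached_def curve_length_def using reachable_refl[of M "\<gamma> x"]
    using integrable_on_refl[of "curve_speed M \<gamma>" x] by auto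
  have right: "\<exists>d>0. \<forall>v. x \<le> v \<and> v < x + d \<and> v \<le> b \<longrightarrow> nearly_reached M \<gamma> \<delta> x v"
    if x: "a \<le> x" "x \<le> b" for x
  proof (cases "x = b")
    case True
    have "nearly_reached M \<gamma> \<delta> x v" if "x \<le> v" "v \<le> b" for v
      using that True refl[of x] by simp
    then show ?thesis
      using zero_less_one by blast
  next
    case False
    \<comment> \<open>No break point other than \<open>x\<close> is closer than \<open>e\<close>, so
      the open interval from \<open>x\<close> to \<open>?y\<close> meets none, even if
      \<open>x\<close> is one itself.\<close>
    obtain e where e: "0 < e" "\<And>t. t \<in> T \<Longrightarrow> t \<noteq> x \<Longrightarrow> e \<le> dist x t"
      using finite_set_avoid[OF T, of x] by blast
    let ?y = "min (x + e) b"
    have "{x<..<?y} \<inter> T = {}"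
      using e(2) by (fastforce simp: dist_real_def)
    moreover have "x < ?y"
      using False x e by auto
    ultimately obtain J \<sigma> where J: "smooth_curve M J \<sigma>" "{x..?y} \<subseteq> J" and \<sigma>: "\<And>u. u \<in> {x..?y} \<Longrightarrow> \<sigma> u = \<gamma> u"
      using piece[of x ?y] x by auto
    have "x \<in> J"
      using J \<open>x < ?y\<close> by auto
    then obtain d where d: "0 < d" and near: "\<And>u v. u \<le> v \<Longrightarrow> {u..v} \<subseteq> {x - d<..<x + d} \<Longrightarrow>
        (\<And>t. t \<in> {u..v} \<Longrightarrow> \<sigma> t = \<gamma> t) \<Longrightarrow> nearly_reached M \<gamma> \<delta> u v"
      using nearly_reached_near[OF M J(1) _ \<open>0 < \<delta>\<close>, of x \<gamma>] by blast
    have "nearly_reached M \<gamma> \<delta> x v" if "x \<le> v" "v < x + min d e" "v \<le> b" for v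
      by (rule near) (use that d \<sigma> in auto)
    then show ?thesis
      using d e(1) by (intro exI[of _ "min d e"]) auto
  qed
  have left: "\<exists>d>0. \<forall>u. u \<le> x \<and> x - d < u \<and> a \<le> u \<longrightarrow> nearly_reached M \<gamma> \<delta> u x"
    if x: "a \<le> x" "x \<le> b" for x
  proof (cases "x = a")
    case True
    have "nearly_reached M \<gamma> \<delta> u x" if "u \<le> x" "a \<le> u" for u
      using that True refl[of x] by simp
    then show ?thesis
      using zero_less_one by blast
  next
    case False
    obtain e where e: "0 < e" "\<And>t. t \<in> T \<Longrightarrow> t \<noteq> x \<Longrightarrow> e \<le> dist x t"
      using finite_set_avoid[OF T, of x] by blast
    let ?y = "max (x - e) a"
    have "{?y<..<x} \<inter> T = {}"
      using e(2) by (fastforce simp: dist_real_def)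
    moreover have "?y < x"
      using False x e by auto
    ultimately obtain J \<sigma> where J: "smooth_curve M J \<sigma>" "{?y..x} \<subseteq> J" and \<sigma>: "\<And>u. u \<in> {?y..x} \<Longrightarrow> \<sigma> u = \<gamma> u"
      using piece[of ?y x] x by auto
    have "x \<in> J"
      using J \<open>?y < x\<close> by auto
    then obtain d where d: "0 < d" and near: "\<And>u v. u \<le> v \<Longrightarrow> {u..v} \<subseteq> {x - d<..<x + d} \<Longrightarrow>
        (\<And>t. t \<in> {u..v} \<Longrightarrow> \<sigma> t = \<gamma> t) \<Longrightarrow> nearly_reached M \<gamma> \<delta> u v"
      using nearly_reached_near[OF M J(1) _ \<open>0 < \<delta>\<close>, of x \<gamma>] by blast
    have "nearly_reached M \<gamma> \<delta> u x" if "u \<le> x" "x - min d e < u" "a \<le> u" for u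
      by (rule near) (use that d \<sigma> in auto)
    then show ?thesis
      using d e(1) by (intro exI[of _ "min d e"]) auto
  qed
  have "a \<le> a \<and> b \<le> b \<longrightarrow> nearly_reached M \<gamma> \<delta> a b"
    using \<open>a \<le> b\<close>
  proof (induction rule: Bolzano[where P = "\<lambda>u v. a \<le> u \<and> v \<le> b \<longrightarrow> nearly_reached M \<gamma> \<delta> u v"])
    case (trans u v w)
    then show ?case
      using nearly_reached_trans[OF M, of \<gamma> \<delta> u v w] by auto
  next
    case (local x)
    obtain d\<^sub>1 where d\<^sub>1: "0 < d\<^sub>1" "\<And>v. x \<le> v \<Longrightarrow> v < x + d\<^sub>1 \<Longrightarrow> v \<le> b \<Longrightarrow> nearly_reached M \<gamma> \<delta> x v"
      using right[OF local] by blast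
    obtain d\<^sub>2 where d\<^sub>2: "0 < d\<^sub>2" "\<And>u. u \<le> x \<Longrightarrow> x - d\<^sub>2 < u \<Longrightarrow> a \<le> u \<Longrightarrow> nearly_reached M \<gamma> \<delta> u x"
      using left[OF local] by blast
    have "nearly_reached M \<gamma> \<delta> u v"
      if "u \<le> x" "x \<le> v" "v - u < min d\<^sub>1 d\<^sub>2" "a \<le> u" "v \<le> b" for u v
      using that by (intro nearly_reached_trans[OF M d\<^sub>2(2) d\<^sub>1(2)]) auto
    then show ?case
      using d\<^sub>1(1) d\<^sub>2(1) by (intro exI[of _ "min d\<^sub>1 d\<^sub>2"]) auto
  qed
  then show ?thesis by simp
qed

section \<open>Riemannian products\<close>

lemma prod_chart_simps [simp]:
  "cdom (prod_chart c c') = cdom c \<times> cdom c'"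
  "cmap (prod_chart c c') = map_prod (cmap c) (cmap c')"
  "cinv (prod_chart c c') = map_prod (cinv c) (cinv c')"
  by (simp_all add: prod_chart_def)

lemma prod_riem_simps [simp]:
  "atlas (prod_riem M N) = {prod_chart c c' | c c'. c \<in> atlas M \<and> c' \<in> atlas N}"
  "chart_at (prod_riem M N) m = prod_chart (chart_at M (fst m)) (chart_at N (snd m))"
  "metric (prod_riem M N) m v w = metric M (fst m) (fst v) (fst w) + metric N (snd m) (snd v) (snd w)"
  by (simp_all add: prod_riem_def)

lemma tnorm_prod:
  assumes "riemannian_manifold M" and "riemannian_manifold N"
  shows "tnorm (prod_riem M N) m v = sqrt ((tnorm M (fst m) (fst v))\<^sup>2 + (tnorm N (snd m) (snd v))\<^sup>2)"
  by (simp add: tnorm_def metric_nonneg assms)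

section \<open>Curves in a product and their components\<close>

lemma smooth_curve_Pair:
  assumes M: "smooth_manifold M" and N: "smooth_manifold N"
    and \<gamma>: "smooth_curve M J \<gamma>" and \<sigma>: "smooth_curve N K \<sigma>"
  shows "smooth_curve (prod_riem M N) (J \<inter> K) (\<lambda>t. (\<gamma> t, \<sigma> t))"
  unfolding smooth_curve_def
proof (intro conjI ballI)
  show "open (J \<inter> K)"
    using \<gamma> \<sigma> unfolding smooth_curve_def by blast
  show "continuous_on (J \<inter> K) (\<lambda>t. (\<gamma> t, \<sigma> t))"
    using \<gamma> \<sigma> unfolding smooth_curve_def by (auto intro: continuous_on_Pair continuous_on_subset)
next
  fix d assume "d \<in> atlas (prod_riem M N)"
  then obtain c c' where c: "c \<in> atlas M" "c' \<in> atlas N" "d = prod_chart c c'"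
    by auto
  let ?S = "(J \<inter> \<gamma> -` cdom c) \<inter> (K \<inter> \<sigma> -` cdom c')"
  have S: "(J \<inter> K) \<inter> (\<lambda>t. (\<gamma> t, \<sigma> t)) -` cdom d = ?S"
    using c by auto
  have "open ?S"
    using open_chart_preimage[OF M \<gamma> c(1)] open_chart_preimage[OF N \<sigma> c(2)] by blast
  moreover have "smooth_on ?S (cmap c \<circ> \<gamma>)" "smooth_on ?S (cmap c' \<circ> \<sigma>)"
    using \<gamma> \<sigma> c unfolding smooth_curve_def by (auto intro: smooth_on_subset)
  ultimately have "smooth_on ?S (\<lambda>t. ((cmap c \<circ> \<gamma>) t, (cmap c' \<circ> \<sigma>) t))"
    unfolding smooth_on_def by (blast intro: Ck_on_Pair)
  then show "smooth_on ((J \<inter> K) \<inter> (\<lambda>t. (\<gamma> t, \<sigma> t)) -` cdom d) (cmap d \<circ> (\<lambda>t. (\<gamma> t, \<sigma> t)))"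
    unfolding S by (simp add: c o_def)
qed

text \<open>In a product chart the component is a linear projection of the smooth coordinate curve.
  Letting the chart of \<open>N\<close> vary covers the whole preimage of \<open>c\<close>, and the
  pieces are glued.\<close>

lemma smooth_curve_fst:
  assumes M: "smooth_manifold M" and N: "smooth_manifold N" and \<gamma>: "smooth_curve (prod_riem M N) J \<gamma>"
  shows "smooth_curve M J (fst \<circ> \<gamma>)"
  unfolding smooth_curve_def
proof (intro conjI ballI)
  show "open J" and "continuous_on J (fst \<circ> \<gamma>)"
    using \<gamma> unfolding smooth_curve_def o_def by (auto intro: continuous_on_fst)
  fix c assume c: "c \<in> atlas M"
  let ?S = "\<lambda>c'. J \<inter> \<gamma> -` cdom (prod_chart c c')"
  have opn: "open (?S c')" if "c' \<in> atlas N" for c'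
    using \<gamma> open_chart(1)[OF M c] open_chart(1)[OF N that] unfolding smooth_curve_def
    by (metis continuous_open_preimage open_Times prod_chart_simps(1))
  have "Ck_on k (?S c') (cmap c \<circ> (fst \<circ> \<gamma>))" if "c' \<in> atlas N" for k c'
  proof -
    have "prod_chart c c' \<in> atlas (prod_riem M N)"
      using c that by auto
    then have "Ck_on k (?S c') (cmap (prod_chart c c') \<circ> \<gamma>)"
      using \<gamma> unfolding smooth_curve_def smooth_on_def by blast
    from Ck_on_bounded_linear[OF this opn[OF that] bounded_linear_fst] show ?thesis
      by (simp add: o_def)
  qed
  then have "smooth_on (\<Union>c'\<in>atlas N. ?S c') (cmap c \<circ> (fst \<circ> \<gamma>))"
    unfolding smooth_on_def using opn by (blast intro: Ck_on_Union)
  moreover have "J \<inter> (fst \<circ> \<gamma>) -` cdom c = (\<Union>c'\<in>atlas N. ?S c')"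
    using chart_at_atlas[OF N] by (fastforce simp: mem_Times_iff)
  ultimately show "smooth_on (J \<inter> (fst \<circ> \<gamma>) -` cdom c) (cmap c \<circ> (fst \<circ> \<gamma>))"
    by simp
qed

lemma smooth_curve_snd:
  assumes M: "smooth_manifold M" and N: "smooth_manifold N" and \<gamma>: "smooth_curve (prod_riem M N) J \<gamma>"
  shows "smooth_curve N J (snd \<circ> \<gamma>)"
  unfolding smooth_curve_def
proof (intro conjI ballI)
  show "open J" and "continuous_on J (snd \<circ> \<gamma>)"
    using \<gamma> unfolding smooth_curve_def o_def by (auto intro: continuous_on_snd)
  fix c' assume c': "c' \<in> atlas N"
  let ?S = "\<lambda>c. J \<inter> \<gamma> -` cdom (prod_chart c c')"
  have opn: "open (?S c)" if "c \<in> atlas M" for c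
    using \<gamma> open_chart(1)[OF N c'] open_chart(1)[OF M that] unfolding smooth_curve_def
    by (metis continuous_open_preimage open_Times prod_chart_simps(1))
  have "Ck_on k (?S c) (cmap c' \<circ> (snd \<circ> \<gamma>))" if "c \<in> atlas M" for k c
  proof -
    have "prod_chart c c' \<in> atlas (prod_riem M N)"
      using c' that by auto
    then have "Ck_on k (?S c) (cmap (prod_chart c c') \<circ> \<gamma>)"
      using \<gamma> unfolding smooth_curve_def smooth_on_def by blast
    from Ck_on_bounded_linear[OF this opn[OF that] bounded_linear_snd] show ?thesis
      by (simp add: o_def)
  qed
  then have "smooth_on (\<Union>c\<in>atlas M. ?S c) (cmap c' \<circ> (snd \<circ> \<gamma>))"
    unfolding smooth_on_def using opn by (blast intro: Ck_on_Union)
  moreover have "J \<inter> (snd \<circ> \<gamma>) -` cdom c' = (\<Union>c\<in>atlas M. ?S c)"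
    using chart_at_atlas[OF M] by (fastforce simp: mem_Times_iff)
  ultimately show "smooth_on (J \<inter> (snd \<circ> \<gamma>) -` cdom c') (cmap c' \<circ> (snd \<circ> \<gamma>))"
    by simp
qed

lemma velocity_Pair:
  assumes "smooth_manifold M" and "smooth_manifold N"
    and "smooth_curve M J \<gamma>" and "t \<in> J" and "smooth_curve N K \<sigma>" and "t \<in> K"
  shows "velocity (prod_riem M N) (\<lambda>t. (\<gamma> t, \<sigma> t)) t = (velocity M \<gamma> t, velocity N \<sigma> t)"
proof -
  have "((\<lambda>s. ((cmap (chart_at M (\<gamma> t)) \<circ> \<gamma>) s, (cmap (chart_at N (\<sigma> t)) \<circ> \<sigma>) s))
      has_vector_derivative (velocity M \<gamma> t, velocity N \<sigma> t)) (at t)"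
    using assms by (intro has_vector_derivative_Pair smooth_curve_has_velocity)
  then show ?thesis
    unfolding velocity_def[of "prod_riem M N"] by (intro vector_derivative_at) (simp add: o_def)
qed

lemma curve_speed_Pair:
  assumes "riemannian_manifold M" and "riemannian_manifold N"
    and "smooth_curve M J \<gamma>" and "t \<in> J" and "smooth_curve N K \<sigma>" and "t \<in> K"
  shows "curve_speed (prod_riem M N) (\<lambda>t. (\<gamma> t, \<sigma> t)) t = sqrt ((curve_speed M \<gamma> t)\<^sup>2 + (curve_speed N \<sigma> t)\<^sup>2)"
  by (simp add: tnorm_prod assms(1,2)
      velocity_Pair[OF riemannian_smooth[OF assms(1)] riemannian_smooth[OF assms(2)] assms(3-)])

section \<open>Metric, Christoffel symbols and geodesics of a product\<close>

lemma has_derivative_map_prod: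
  assumes "(f has_derivative f') (at x)" and "(g has_derivative g') (at y)"
  shows "(map_prod f g has_derivative map_prod f' g') (at (x, y))"
proof -
  have "((\<lambda>z. f (fst z)) has_derivative (\<lambda>h. f' (fst h))) (at (x, y))"
    using diff_chain_at[OF has_derivative_fst[OF has_derivative_ident], of f f' "(x, y)"] assms(1)
    by (simp add: o_def)
  moreover have "((\<lambda>z. g (snd z)) has_derivative (\<lambda>h. g' (snd h))) (at (x, y))"
    using diff_chain_at[OF has_derivative_snd[OF has_derivative_ident], of g g' "(x, y)"] assms(2)
    by (simp add: o_def)
  ultimately show ?thesis
    by (simp add: map_prod_def case_prod_unfold has_derivative_Pair)
qed

text \<open>The preferred charts of the product are products, so the change of coordinates acts on
  the two components separately and the coordinate metric is block diagonal.\<close>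

lemma coord_metric_prod:
  assumes M: "smooth_manifold M" and N: "smooth_manifold N" and c: "c \<in> atlas M" "c' \<in> atlas N"
    and x: "x \<in> cmap c ` cdom c" and y: "y \<in> cmap c' ` cdom c'"
  shows "coord_metric (prod_riem M N) (prod_chart c c') (x, y) u v =
    coord_metric M c x (fst u) (fst v) + coord_metric N c' y (snd u) (snd v)"
proof -
  obtain p q where p: "p \<in> cdom c" "x = cmap c p" and q: "q \<in> cdom c'" "y = cmap c' q"
    using x y by blast
  have inv: "cinv c x = p" "cinv c' y = q"
    using chart_inverse[OF M c(1) p(1)] chart_inverse[OF N c(2) q(1)] p q by auto
  have "(map_prod (cmap (chart_at M p) \<circ> cinv c) (cmap (chart_at N q) \<circ> cinv c')
      has_derivative map_prod (from_coord M c p) (from_coord N c' q)) (at (x, y))"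
    unfolding p(2) q(2)
    by (intro has_derivative_map_prod from_coord_has_derivative M N c p(1) q(1))
  then have "from_coord (prod_riem M N) (prod_chart c c') (p, q) u =
      map_prod (from_coord M c p) (from_coord N c' q) u" for u
    using p(2) q(2) by (simp add: from_coord_def[of "prod_riem M N"] map_prod.comp flip: frechet_derivative_at)
  then show ?thesis
    by (simp add: coord_metric_def inv)
qed

text \<open>Each block of the metric depends on the coordinates of its own factor alone, so there
  are no mixed derivatives.\<close>

lemma christoffel_prod:
  assumes M: "riemannian_manifold M" and N: "riemannian_manifold N" and c: "c \<in> atlas M" "c' \<in> atlas N"
    and x: "x \<in> cmap c ` cdom c" and y: "y \<in> cmap c' ` cdom c'"
  shows "christoffel (prod_riem M N) (prod_chart c c') (x, y) u v w =
    christoffel M c x (fst u) (fst v) (fst w) + christoffel N c' y (snd u) (snd v) (snd w)"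
proof -
  note SM = riemannian_smooth[OF M] and SN = riemannian_smooth[OF N]
  let ?U = "(cmap c ` cdom c) \<times> (cmap c' ` cdom c')"
  have opn: "open ?U" and mem: "(x, y) \<in> ?U"
    using open_chart(2)[OF SM c(1)] open_chart(2)[OF SN c(2)] x y by (auto intro: open_Times)
  have "frechet_derivative (\<lambda>z. coord_metric (prod_riem M N) (prod_chart c c') z u v) (at (x, y)) =
      (\<lambda>w. frechet_derivative (\<lambda>y. coord_metric M c y (fst u) (fst v)) (at x) (fst w)
        + frechet_derivative (\<lambda>y. coord_metric N c' y (snd u) (snd v)) (at y) (snd w))" for u v
  proof (rule frechet_derivative_at[symmetric])
    let ?F = "frechet_derivative (\<lambda>y. coord_metric M c y (fst u) (fst v)) (at x)"
    let ?G = "frechet_derivative (\<lambda>y. coord_metric N c' y (snd u) (snd v)) (at y)"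
    have "((\<lambda>z. coord_metric M c (fst z) (fst u) (fst v)) has_derivative (\<lambda>w. ?F (fst w))) (at (x, y))"
      using diff_chain_at[OF has_derivative_fst[OF has_derivative_ident], of _ ?F "(x, y)"]
        coord_metric_has_derivative[OF M c(1) x, of "fst u" "fst v"] by (fastforce simp: o_def)
    moreover have "((\<lambda>z. coord_metric N c' (snd z) (snd u) (snd v)) has_derivative (\<lambda>w. ?G (snd w))) (at (x, y))"
      using diff_chain_at[OF has_derivative_snd[OF has_derivative_ident], of _ ?G "(x, y)"]
        coord_metric_has_derivative[OF N c(2) y, of "snd u" "snd v"] by (fastforce simp: o_def)
    ultimately have "((\<lambda>z. coord_metric M c (fst z) (fst u) (fst v) + coord_metric N c' (snd z) (snd u) (snd v))
        has_derivative (\<lambda>w. ?F (fst w) + ?G (snd w))) (at (x, y))"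
      by (rule has_derivative_add)
    then show "((\<lambda>z. coord_metric (prod_riem M N) (prod_chart c c') z u v) has_derivative
        (\<lambda>w. ?F (fst w) + ?G (snd w))) (at (x, y))"
      by (rule has_derivative_transform_within_open[OF _ opn mem])
        (auto simp: coord_metric_prod[OF SM SN c])
  qed
  then show ?thesis
    by (simp add: christoffel_def field_simps)
qed

lemma coord_metric_zero_right:
  assumes "riemannian_manifold M" and "c \<in> atlas M" and "y \<in> cmap c ` cdom c"
  shows "coord_metric M c y u 0 = 0"
  by (rule bilinear_rzero[OF bilinear_coord_metric[OF assms]])

text \<open>Two of the three terms differentiate the metric paired with 0, which vanishes on the
  open image of the chart; the third is a derivative in the direction 0.\<close>

lemma christoffel_zero_right:
  assumes M: "riemannian_manifold M" and c: "c \<in> atlas M" and y: "y \<in> cmap c ` cdom c"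
  shows "christoffel M c y u v 0 = 0"
proof -
  have "frechet_derivative (\<lambda>y. coord_metric M c y u 0) (at y) = (\<lambda>_. 0)" for u
  proof (rule frechet_derivative_at[symmetric])
    show "((\<lambda>y. coord_metric M c y u 0) has_derivative (\<lambda>_. 0)) (at y)"
      by (rule has_derivative_transform_within_open[OF has_derivative_const[of 0]
            open_chart(2)[OF riemannian_smooth[OF M] c] y])
        (simp add: coord_metric_zero_right[OF M c])
  qed
  moreover have "frechet_derivative (\<lambda>y. coord_metric M c y u v) (at y) 0 = 0"
    by (rule linear_0[OF has_derivative_linear[OF coord_metric_has_derivative[OF assms]]])
  ultimately show ?thesis
    by (simp add: christoffel_def)
qed

text \<open>The geodesic equation of the product is the sum of those of the factors. As the test
  vectors \<open>u\<close> and \<open>v\<close> are independent, setting one of them to 0 separates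
  the two equations.\<close>

lemma geodesic_equation_prod:
  assumes M: "riemannian_manifold M" and N: "riemannian_manifold N"
    and \<gamma>: "geodesic (prod_riem M N) J \<gamma>" and c: "c \<in> atlas M" "c' \<in> atlas N"
    and t: "t \<in> J" "fst (\<gamma> t) \<in> cdom c" "snd (\<gamma> t) \<in> cdom c'"
  defines "x \<equiv> cmap c \<circ> (fst \<circ> \<gamma>)" and "y \<equiv> cmap c' \<circ> (snd \<circ> \<gamma>)"
  defines "x' \<equiv> \<lambda>s. vector_derivative x (at s)" and "y' \<equiv> \<lambda>s. vector_derivative y (at s)"
  defines "x'' \<equiv> vector_derivative x' (at t)" and "y'' \<equiv> vector_derivative y' (at t)"
  shows "coord_metric M c (x t) x'' u + christoffel M c (x t) (x' t) (x' t) u +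
    (coord_metric N c' (y t) y'' v + christoffel N c' (y t) (y' t) (y' t) v) = 0"
proof -
  note SM = riemannian_smooth[OF M] and SN = riemannian_smooth[OF N]
  have sm: "smooth_curve (prod_riem M N) J \<gamma>"
    using \<gamma> by (simp add: geodesic_def)
  note sm1 = smooth_curve_fst[OF SM SN sm] and sm2 = smooth_curve_snd[OF SM SN sm]
  let ?d = "prod_chart c c'"
  let ?z = "cmap ?d \<circ> \<gamma>"
  let ?U = "(J \<inter> (fst \<circ> \<gamma>) -` cdom c) \<inter> (J \<inter> (snd \<circ> \<gamma>) -` cdom c')"
  have opn: "open ?U"
    using open_chart_preimage[OF SM sm1 c(1)] open_chart_preimage[OF SN sm2 c(2)] by blast
  have tU: "t \<in> ?U"
    using t by simp
  have z: "?z = (\<lambda>s. (x s, y s))"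
    by (auto simp: x_def y_def fun_eq_iff map_prod_def case_prod_unfold)
  \<comment> \<open>The first derivative is computed on a neighbourhood of \<open>t\<close> because
    it is differentiated once more.\<close>
  have z': "vector_derivative ?z (at s) = (x' s, y' s)" if "s \<in> ?U" for s
    unfolding z x'_def y'_def x_def y_def
    by (intro vector_derivative_at has_vector_derivative_Pair
        smooth_curve_coord(1)[OF SM sm1 c(1)] smooth_curve_coord(1)[OF SN sm2 c(2)])
      (use that in auto)
  have "((\<lambda>s. (x' s, y' s)) has_vector_derivative (x'', y'')) (at t)"
    unfolding x'_def y'_def x''_def y''_def x_def y_def
    by (intro has_vector_derivative_Pair smooth_curve_coord(2)[OF SM sm1 c(1)] smooth_curve_coord(2)[OF SN sm2 c(2)])
      (use t in auto)
  then have "((\<lambda>s. vector_derivative ?z (at s)) has_vector_derivative (x'', y'')) (at t)"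
    by (rule has_vector_derivative_transform_within_open[OF _ opn tU]) (rule z'[symmetric])
  then have z'': "vector_derivative (\<lambda>s. vector_derivative ?z (at s)) (at t) = (x'', y'')"
    by (rule vector_derivative_at)
  have "?d \<in> atlas (prod_riem M N)" "\<gamma> t \<in> cdom ?d"
    using c t by (auto simp: mem_Times_iff)
  then have "\<forall>w. coord_metric (prod_riem M N) ?d (?z t) (vector_derivative (\<lambda>s. vector_derivative ?z (at s)) (at t)) w
      + christoffel (prod_riem M N) ?d (?z t) (vector_derivative ?z (at t)) (vector_derivative ?z (at t)) w = 0"
    using \<gamma> t(1) unfolding geodesic_def Let_def by blast
  then have "coord_metric (prod_riem M N) ?d (x t, y t) (x'', y'') (u, v)
      + christoffel (prod_riem M N) ?d (x t, y t) (x' t, y' t) (x' t, y' t) (u, v) = 0"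
    unfolding z'' z'[OF tU] unfolding z by blast
  moreover have "x t \<in> cmap c ` cdom c" "y t \<in> cmap c' ` cdom c'"
    using t by (auto simp: x_def y_def)
  ultimately show ?thesis
    by (simp add: coord_metric_prod[OF SM SN c] christoffel_prod[OF M N c])
qed

lemma geodesic_fst:
  assumes M: "riemannian_manifold M" and N: "riemannian_manifold N"
    and \<gamma>: "geodesic (prod_riem M N) J \<gamma>"
  shows "geodesic M J (fst \<circ> \<gamma>)"
  unfolding geodesic_def Let_def
proof (intro conjI ballI impI allI)
  note SM = riemannian_smooth[OF M] and SN = riemannian_smooth[OF N]
  show "smooth_curve M J (fst \<circ> \<gamma>)"
    using \<gamma> smooth_curve_fst[OF SM SN] by (simp add: geodesic_def)
  fix c t w assume c: "c \<in> atlas M" and t: "t \<in> J" "(fst \<circ> \<gamma>) t \<in> cdom c"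
  \<comment> \<open>The test vector \<open>(w, 0)\<close> removes the contribution of
    \<open>N\<close>; some chart of \<open>N\<close> around the second component is needed to form
    the product chart.\<close>
  let ?d = "chart_at N (snd (\<gamma> t))"
  note d = chart_at_atlas[OF SN, of "snd (\<gamma> t)"]
  have y: "(cmap ?d \<circ> (snd \<circ> \<gamma>)) t \<in> cmap ?d ` cdom ?d"
    using d by simp
  show "coord_metric M c ((cmap c \<circ> (fst \<circ> \<gamma>)) t)
      (vector_derivative (\<lambda>s. vector_derivative (cmap c \<circ> (fst \<circ> \<gamma>)) (at s)) (at t)) w +
    christoffel M c ((cmap c \<circ> (fst \<circ> \<gamma>)) t) (vector_derivative (cmap c \<circ> (fst \<circ> \<gamma>)) (at t))
      (vector_derivative (cmap c \<circ> (fst \<circ> \<gamma>)) (at t)) w = 0"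
    using geodesic_equation_prod[OF M N \<gamma> c d(1) t(1) _ d(2), of w 0] t(2)
    by (simp only: o_apply coord_metric_zero_right[OF N d(1) y[unfolded o_apply]]
        christoffel_zero_right[OF N d(1) y[unfolded o_apply]] add_0_right)
qed

lemma geodesic_snd:
  assumes M: "riemannian_manifold M" and N: "riemannian_manifold N"
    and \<gamma>: "geodesic (prod_riem M N) J \<gamma>"
  shows "geodesic N J (snd \<circ> \<gamma>)"
  unfolding geodesic_def Let_def
proof (intro conjI ballI impI allI)
  note SM = riemannian_smooth[OF M] and SN = riemannian_smooth[OF N]
  show "smooth_curve N J (snd \<circ> \<gamma>)"
    using \<gamma> smooth_curve_snd[OF SM SN] by (simp add: geodesic_def)
  fix c t w assume c: "c \<in> atlas N" and t: "t \<in> J" "(snd \<circ> \<gamma>) t \<in> cdom c"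
  let ?d = "chart_at M (fst (\<gamma> t))"
  note d = chart_at_atlas[OF SM, of "fst (\<gamma> t)"]
  have x: "(cmap ?d \<circ> (fst \<circ> \<gamma>)) t \<in> cmap ?d ` cdom ?d"
    using d by simp
  show "coord_metric N c ((cmap c \<circ> (snd \<circ> \<gamma>)) t)
      (vector_derivative (\<lambda>s. vector_derivative (cmap c \<circ> (snd \<circ> \<gamma>)) (at s)) (at t)) w +
    christoffel N c ((cmap c \<circ> (snd \<circ> \<gamma>)) t) (vector_derivative (cmap c \<circ> (snd \<circ> \<gamma>)) (at t))
      (vector_derivative (cmap c \<circ> (snd \<circ> \<gamma>)) (at t)) w = 0"
    using geodesic_equation_prod[OF M N \<gamma> d(1) c t(1) d(2), of 0 w] t(2)
    by (simp only: o_apply coord_metric_zero_right[OF M d(1) x[unfolded o_apply]]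
        christoffel_zero_right[OF M d(1) x[unfolded o_apply]] add_0_left)
qed

section \<open>The geodesic distance of a product\<close>

text \<open>If the speed is not integrable, the length is 0 by the default value of
  \<open>integral\<close>, so the bound holds for arbitrary functions.\<close>

lemma curve_length_nonneg:
  assumes "\<And>p v. 0 \<le> metric M p v v"
  shows "0 \<le> curve_length M \<gamma> a b"
  unfolding curve_length_def
  by (cases "curve_speed M \<gamma> integrable_on {a..b}")
    (auto intro!: integral_nonneg simp: tnorm_def assms not_integrable_integral)

text \<open>The length bound 0 makes the infimum a lower bound of the set. Nonnegativity of the
  metric is the form of the hypothesis that also suits \<open>prod_riem M N\<close>.\<close>

lemma geo_dist_le:
  assumes "\<And>p v. 0 \<le> metric M p v v" and "piecewise_smooth_curve M \<gamma> 0 1"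
  shows "geo_dist M (\<gamma> 0) (\<gamma> 1) \<le> curve_length M \<gamma> 0 1"
  unfolding geo_dist_def
proof (rule cInf_lower)
  show "bdd_below {curve_length M \<sigma> 0 1 |\<sigma>. piecewise_smooth_curve M \<sigma> 0 1 \<and> \<sigma> 0 = \<gamma> 0 \<and> \<sigma> 1 = \<gamma> 1}"
    by (rule bdd_belowI[of _ 0]) (auto intro: curve_length_nonneg assms(1))
qed (use assms(2) in blast)

lemma geo_dist_nonneg:
  assumes "riemannian_manifold M" and "piecewise_smooth_curve M \<gamma> 0 1"
  shows "0 \<le> geo_dist M (\<gamma> 0) (\<gamma> 1)"
  unfolding geo_dist_def
  by (rule cInf_greatest) (use assms in \<open>auto intro: curve_length_nonneg metric_nonneg\<close>)

text \<open>Half of \<open>e\<close> is spent on a curve close to the infimum and half on its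
  reparametrization. The curve \<open>\<gamma>\<close> guarantees that the infimum is taken over a
  nonempty set.\<close>

lemma reachable_geo_dist:
  assumes M: "riemannian_manifold M" and \<gamma>: "piecewise_smooth_curve M \<gamma> 0 1" and "0 < e"
  obtains l where "0 < l" and "reachable M (\<gamma> 0) (\<gamma> 1) l" and "l \<le> geo_dist M (\<gamma> 0) (\<gamma> 1) + e"
proof -
  let ?S = "{curve_length M \<sigma> 0 1 |\<sigma>. piecewise_smooth_curve M \<sigma> 0 1 \<and> \<sigma> 0 = \<gamma> 0 \<and> \<sigma> 1 = \<gamma> 1}"
  have "?S \<noteq> {}"
    using \<gamma> by blast
  moreover have "Inf ?S < geo_dist M (\<gamma> 0) (\<gamma> 1) + e / 2"
    using \<open>0 < e\<close> by (simp add: geo_dist_def)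
  ultimately obtain s where "s \<in> ?S" "s < geo_dist M (\<gamma> 0) (\<gamma> 1) + e / 2"
    by (rule cInf_lessD[THEN bexE])
  then obtain \<sigma> where \<sigma>: "piecewise_smooth_curve M \<sigma> 0 1" "\<sigma> 0 = \<gamma> 0" "\<sigma> 1 = \<gamma> 1"
      "curve_length M \<sigma> 0 1 < geo_dist M (\<gamma> 0) (\<gamma> 1) + e / 2"
    by blast
  have "nearly_reached M \<sigma> (e / 2) 0 1"
    by (rule piecewise_smooth_nearly_reached[OF M \<sigma>(1)]) (use \<open>0 < e\<close> in auto)
  then obtain l where "reachable M (\<gamma> 0) (\<gamma> 1) l" "0 < l" "l \<le> curve_length M \<sigma> 0 1 + e / 2"
    unfolding nearly_reached_def using \<sigma>(2,3) by auto
  then show thesis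
    using \<sigma>(4) that[of l] by linarith
qed

lemma curve_length_le:
  assumes "speed_bounded M \<gamma> 0 1 k" and "0 \<le> k"
  shows "curve_length M \<gamma> 0 1 \<le> k"
proof (cases "curve_speed M \<gamma> integrable_on {0..1}")
  case True
  obtain T where T: "finite T" "\<And>t. t \<in> {0<..<1} - T \<Longrightarrow> curve_speed M \<gamma> t \<le> k"
    using assms(1) unfolding speed_bounded_def by blast
  let ?T = "insert 0 (insert 1 T)"
  \<comment> \<open>The speed is uncontrolled on finitely many parameters. Setting it to 0 there
    changes neither integrability nor the integral, and 0 is below \<open>k\<close>.\<close>
  let ?g = "\<lambda>t. if t \<in> ?T then 0 else curve_speed M \<gamma> t"
  have fin: "finite ?T"
    using T(1) by simp
  have g: "?g integrable_on {0..1}"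
    by (rule integrable_spike_finite[OF fin _ True]) auto
  have "curve_length M \<gamma> 0 1 = integral {0..1} ?g"
    unfolding curve_length_def by (rule integral_spike[of ?T]) (use fin in \<open>auto intro: negligible_finite\<close>)
  also have "\<dots> \<le> integral {0..1::real} (\<lambda>_. k)"
  proof (rule integral_le[OF g])
    fix t :: real assume "t \<in> {0..1}"
    then show "?g t \<le> k"
      using T(2)[of t] assms(2) by auto
  qed (rule integrable_const_ivl)
  finally show ?thesis by simp
qed (use assms(2) in \<open>simp add: curve_length_def not_integrable_integral\<close>)

section \<open>Pairing curves of the factors\<close>

lemma piecewise_smooth_Pair:
  assumes M: "smooth_manifold M" and N: "smooth_manifold N"
    and "piecewise_smooth_curve M \<gamma> a b" and "piecewise_smooth_curve N \<sigma> a b"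
  shows "piecewise_smooth_curve (prod_riem M N) (\<lambda>t. (\<gamma> t, \<sigma> t)) a b"
proof -
  obtain T where T: "finite T" "\<And>s t. a \<le> s \<Longrightarrow> s < t \<Longrightarrow> t \<le> b \<Longrightarrow> {s<..<t} \<inter> T = {} \<Longrightarrow>
      \<exists>J \<rho>. smooth_curve M J \<rho> \<and> {s..t} \<subseteq> J \<and> (\<forall>u\<in>{s..t}. \<rho> u = \<gamma> u)"
    using assms(3) unfolding piecewise_smooth_curve_def by metis
  obtain T' where T': "finite T'" "\<And>s t. a \<le> s \<Longrightarrow> s < t \<Longrightarrow> t \<le> b \<Longrightarrow> {s<..<t} \<inter> T' = {} \<Longrightarrow>
      \<exists>J \<rho>. smooth_curve N J \<rho> \<and> {s..t} \<subseteq> J \<and> (\<forall>u\<in>{s..t}. \<rho> u = \<sigma> u)"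
    using assms(4) unfolding piecewise_smooth_curve_def by metis
  show ?thesis
    unfolding piecewise_smooth_curve_def
  proof (rule exI, intro conjI allI impI)
    show "finite (T \<union> T')"
      using T(1) T'(1) by simp
  next
    fix s t assume "a \<le> s \<and> s < t \<and> t \<le> b \<and> {s<..<t} \<inter> (T \<union> T') = {}"
    then have st: "a \<le> s" "s < t" "t \<le> b" "{s<..<t} \<inter> T = {}" "{s<..<t} \<inter> T' = {}"
      by blast+
    obtain J \<rho> where J: "smooth_curve M J \<rho>" "{s..t} \<subseteq> J" "\<forall>u\<in>{s..t}. \<rho> u = \<gamma> u"
      using T(2)[OF st(1-4)] by blast
    obtain K \<tau> where K: "smooth_curve N K \<tau>" "{s..t} \<subseteq> K" "\<forall>u\<in>{s..t}. \<tau> u = \<sigma> u"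
      using T'(2)[OF st(1-3,5)] by blast
    show "\<exists>J \<rho>. smooth_curve (prod_riem M N) J \<rho> \<and> {s..t} \<subseteq> J \<and> (\<forall>u\<in>{s..t}. \<rho> u = (\<gamma> u, \<sigma> u))"
      by (rule exI[of _ "J \<inter> K"], rule exI[of _ "\<lambda>t. (\<rho> t, \<tau> t)"])
        (use smooth_curve_Pair[OF M N J(1) K(1)] J K in simp)
  qed
qed

lemma speed_bounded_Pair:
  assumes M: "riemannian_manifold M" and N: "riemannian_manifold N"
    and "speed_bounded M \<gamma> a b k" and "speed_bounded N \<sigma> a b l"
  shows "speed_bounded (prod_riem M N) (\<lambda>t. (\<gamma> t, \<sigma> t)) a b (sqrt (k\<^sup>2 + l\<^sup>2))"
proof -
  obtain T where T: "finite T" "\<And>t. t \<in> {a<..<b} - T \<Longrightarrow>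
      (\<exists>U. t \<in> U \<and> smooth_curve M U \<gamma>) \<and> curve_speed M \<gamma> t \<le> k"
    using assms(3) unfolding speed_bounded_def by blast
  obtain T' where T': "finite T'" "\<And>t. t \<in> {a<..<b} - T' \<Longrightarrow>
      (\<exists>U. t \<in> U \<and> smooth_curve N U \<sigma>) \<and> curve_speed N \<sigma> t \<le> l"
    using assms(4) unfolding speed_bounded_def by blast
  have "(\<exists>U. t \<in> U \<and> smooth_curve (prod_riem M N) U (\<lambda>t. (\<gamma> t, \<sigma> t))) \<and>
      curve_speed (prod_riem M N) (\<lambda>t. (\<gamma> t, \<sigma> t)) t \<le> sqrt (k\<^sup>2 + l\<^sup>2)"
    if t: "t \<in> {a<..<b} - (T \<union> T')" for t
  proof -
    obtain U where U: "t \<in> U" "smooth_curve M U \<gamma>" "curve_speed M \<gamma> t \<le> k"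
      using T(2)[of t] t by blast
    obtain V where V: "t \<in> V" "smooth_curve N V \<sigma>" "curve_speed N \<sigma> t \<le> l"
      using T'(2)[of t] t by blast
    have "smooth_curve (prod_riem M N) (U \<inter> V) (\<lambda>t. (\<gamma> t, \<sigma> t))"
      by (rule smooth_curve_Pair[OF riemannian_smooth[OF M] riemannian_smooth[OF N] U(2) V(2)])
    moreover have "(curve_speed M \<gamma> t)\<^sup>2 + (curve_speed N \<sigma> t)\<^sup>2 \<le> k\<^sup>2 + l\<^sup>2"
      by (intro add_mono power_mono U(3) V(3) tnorm_nonneg M N)
    then have "curve_speed (prod_riem M N) (\<lambda>t. (\<gamma> t, \<sigma> t)) t \<le> sqrt (k\<^sup>2 + l\<^sup>2)"
      unfolding curve_speed_Pair[OF M N U(2,1) V(2,1)] by (rule real_sqrt_le_mono)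
    ultimately show ?thesis
      using U(1) V(1) by blast
  qed
  moreover have "finite (T \<union> T')"
    using T(1) T'(1) by simp
  ultimately show ?thesis
    unfolding speed_bounded_def by blast
qed

text \<open>Both curves are rescaled to the unit interval, where their speeds are at most
  \<open>l\<close> and \<open>k\<close>. The speed bound of the pair then holds pointwise and
  integrates to the same number.\<close>

lemma geo_dist_prod_le_reachable:
  assumes M: "riemannian_manifold M" and N: "riemannian_manifold N"
    and "reachable M p x l" and "reachable N q y k" and "0 < l" and "0 < k"
  shows "geo_dist (prod_riem M N) (p, q) (x, y) \<le> sqrt (l\<^sup>2 + k\<^sup>2)"
proof -
  note SM = riemannian_smooth[OF M] and SN = riemannian_smooth[OF N]
  obtain \<gamma> where \<gamma>: "piecewise_smooth_curve M \<gamma> 0 l" "\<gamma> 0 = p" "\<gamma> l = x" "speed_bounded M \<gamma> 0 l 1"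
    using assms(3) unfolding reachable_def by blast
  obtain \<sigma> where \<sigma>: "piecewise_smooth_curve N \<sigma> 0 k" "\<sigma> 0 = q" "\<sigma> k = y" "speed_bounded N \<sigma> 0 k 1"
    using assms(4) unfolding reachable_def by blast
  let ?\<rho> = "\<lambda>t. (\<gamma> (l * t + 0), \<sigma> (k * t + 0))"
  have "piecewise_smooth_curve (prod_riem M N) ?\<rho> 0 1"
    by (intro piecewise_smooth_Pair[OF SM SN] piecewise_smooth_affine SM SN) (use \<gamma> \<sigma> assms(5,6) in auto)
  then have "geo_dist (prod_riem M N) (?\<rho> 0) (?\<rho> 1) \<le> curve_length (prod_riem M N) ?\<rho> 0 1"
    by (intro geo_dist_le) (simp_all add: metric_nonneg[OF M] metric_nonneg[OF N])
  also have "\<dots> \<le> sqrt ((l * 1)\<^sup>2 + (k * 1)\<^sup>2)"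
    by (intro curve_length_le speed_bounded_Pair[OF M N] speed_bounded_affine M N)
      (use \<gamma> \<sigma> assms(5,6) in auto)
  finally show ?thesis
    using \<gamma>(2,3) \<sigma>(2,3) by simp
qed

text \<open>The loss e/2 in each factor costs at most e in the product, by the triangle inequality
  in the plane for (a, b) and (e/2, e/2). The given curves witness that both distances are infima
  over nonempty sets; later they are the components of a geodesic.\<close>

lemma geo_dist_prod_le:
  assumes M: "riemannian_manifold M" and N: "riemannian_manifold N"
    and \<gamma>: "piecewise_smooth_curve M \<gamma> 0 1" and \<sigma>: "piecewise_smooth_curve N \<sigma> 0 1"
  shows "geo_dist (prod_riem M N) (\<gamma> 0, \<sigma> 0) (\<gamma> 1, \<sigma> 1) \<le>
    sqrt ((geo_dist M (\<gamma> 0) (\<gamma> 1))\<^sup>2 + (geo_dist N (\<sigma> 0) (\<sigma> 1))\<^sup>2)" (is "?d \<le> sqrt (?a\<^sup>2 + ?b\<^sup>2)")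
proof (rule field_le_epsilon)
  fix e :: real assume "0 < e"
  then have e: "0 < e / 2"
    by simp
  obtain l where l: "0 < l" "reachable M (\<gamma> 0) (\<gamma> 1) l" "l \<le> ?a + e / 2"
    using reachable_geo_dist[OF M \<gamma> e] .
  obtain k where k: "0 < k" "reachable N (\<sigma> 0) (\<sigma> 1) k" "k \<le> ?b + e / 2"
    using reachable_geo_dist[OF N \<sigma> e] .
  have "?d \<le> sqrt (l\<^sup>2 + k\<^sup>2)"
    by (rule geo_dist_prod_le_reachable[OF M N l(2) k(2) l(1) k(1)])
  also have "\<dots> \<le> sqrt ((?a + e / 2)\<^sup>2 + (?b + e / 2)\<^sup>2)"
    using l k by (intro real_sqrt_le_mono add_mono power_mono) auto
  also have "\<dots> \<le> sqrt (?a\<^sup>2 + ?b\<^sup>2) + sqrt ((e / 2)\<^sup>2 + (e / 2)\<^sup>2)"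
    by (rule real_sqrt_sum_squares_triangle_ineq)
  also have "sqrt ((e / 2)\<^sup>2 + (e / 2)\<^sup>2) \<le> e"
    using sqrt_sum_squares_le_sum[of "e / 2" "e / 2"] e by simp
  finally show "?d \<le> sqrt (?a\<^sup>2 + ?b\<^sup>2) + e"
    by simp
qed

section \<open>Minimizing geodesics of a product and the logarithm\<close>

lemma geodesic_piecewise_smooth:
  assumes "geodesic M J \<gamma>" and "{a..b} \<subseteq> J"
  shows "piecewise_smooth_curve M \<gamma> a b"
  unfolding piecewise_smooth_curve_def using assms
  by (intro exI[of _ "{}"] conjI allI impI exI[of _ J] exI[of _ \<gamma>]) (auto simp: geodesic_def)

lemma minimizing_geodesic_prod:
  assumes M: "riemannian_manifold M" and N: "riemannian_manifold N"
    and \<gamma>: "minimizing_geodesic (prod_riem M N) \<gamma> 0 1"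
  shows "minimizing_geodesic M (fst \<circ> \<gamma>) 0 1" and "minimizing_geodesic N (snd \<circ> \<gamma>) 0 1"
proof -
  note SM = riemannian_smooth[OF M] and SN = riemannian_smooth[OF N]
  obtain J where J: "{0..1} \<subseteq> J" "geodesic (prod_riem M N) J \<gamma>"
    and len: "curve_length (prod_riem M N) \<gamma> 0 1 = geo_dist (prod_riem M N) (\<gamma> 0) (\<gamma> 1)"
    using \<gamma> unfolding minimizing_geodesic_def by blast
  note g1 = geodesic_fst[OF M N J(2)] and g2 = geodesic_snd[OF M N J(2)]
  note pw1 = geodesic_piecewise_smooth[OF g1 J(1)] and pw2 = geodesic_piecewise_smooth[OF g2 J(1)]
  let ?a = "curve_length M (fst \<circ> \<gamma>) 0 1" and ?b = "curve_length N (snd \<circ> \<gamma>) 0 1"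
  let ?dM = "geo_dist M ((fst \<circ> \<gamma>) 0) ((fst \<circ> \<gamma>) 1)" and ?dN = "geo_dist N ((snd \<circ> \<gamma>) 0) ((snd \<circ> \<gamma>) 1)"
  \<comment> \<open>On the unit interval a constant speed equals the length, so \<open>?a\<close>
    and \<open>?b\<close> are the speeds of the components.\<close>
  have speed: "curve_speed (prod_riem M N) \<gamma> t = sqrt (?a\<^sup>2 + ?b\<^sup>2)" if t: "t \<in> {0..1}" for t
  proof -
    have "t \<in> J"
      using t J(1) by blast
    then have "curve_speed (prod_riem M N) (\<lambda>t. ((fst \<circ> \<gamma>) t, (snd \<circ> \<gamma>) t)) t =
        sqrt ((curve_speed M (fst \<circ> \<gamma>) t)\<^sup>2 + (curve_speed N (snd \<circ> \<gamma>) t)\<^sup>2)"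
      using curve_speed_Pair[OF M N conjunct1[OF g1[unfolded geodesic_def]] _ conjunct1[OF g2[unfolded geodesic_def]]]
      by blast
    moreover have "curve_speed M (fst \<circ> \<gamma>) t = ?a" "curve_speed N (snd \<circ> \<gamma>) t = ?b"
      unfolding geodesic_curve_length[OF M g1 J(1)] geodesic_curve_length[OF N g2 J(1)]
      by (rule geodesic_constant_speed[OF M g1 J(1) t], simp)
        (rule geodesic_constant_speed[OF N g2 J(1) t], simp)
    ultimately show ?thesis
      by simp
  qed
  have "curve_length (prod_riem M N) \<gamma> 0 1 = integral {0..1::real} (\<lambda>_. sqrt (?a\<^sup>2 + ?b\<^sup>2))"
    unfolding curve_length_def[of "prod_riem M N"]
    by (rule Henstock_Kurzweil_Integration.integral_cong) (rule speed)
  then have "sqrt (?a\<^sup>2 + ?b\<^sup>2) = geo_dist (prod_riem M N) (\<gamma> 0) (\<gamma> 1)"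
    using len by simp
  also have "\<dots> \<le> sqrt (?dM\<^sup>2 + ?dN\<^sup>2)"
    using geo_dist_prod_le[OF M N pw1 pw2] by simp
  finally have "?a\<^sup>2 + ?b\<^sup>2 \<le> ?dM\<^sup>2 + ?dN\<^sup>2"
    by simp
  moreover have le: "?dM \<le> ?a" "?dN \<le> ?b"
    by (intro geo_dist_le metric_nonneg M N pw1 pw2)+
  moreover have nn: "0 \<le> ?dM" "0 \<le> ?dN"
    using geo_dist_nonneg[OF M pw1] geo_dist_nonneg[OF N pw2] by auto
  moreover have "?dM\<^sup>2 \<le> ?a\<^sup>2" "?dN\<^sup>2 \<le> ?b\<^sup>2"
    using le nn by (intro power_mono; simp)+
  \<comment> \<open>Each square on the left is at least its counterpart on the right, so the
    inequality between the sums forces equality term by term.\<close>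
  ultimately have "?a\<^sup>2 = ?dM\<^sup>2" "?b\<^sup>2 = ?dN\<^sup>2"
    by linarith+
  then have "?a = ?dM" "?b = ?dN"
    using le nn by (metis order_trans power2_eq_iff_nonneg)+
  then show "minimizing_geodesic M (fst \<circ> \<gamma>) 0 1" "minimizing_geodesic N (snd \<circ> \<gamma>) 0 1"
    unfolding minimizing_geodesic_def using J(1) g1 g2 by blast+
qed

text \<open>Every minimizing geodesic over the unit interval has the distance as its constant speed,
  so the norm does not depend on which initial velocity \<open>SOME\<close> selects.\<close>

lemma tnorm_riem_log:
  assumes M: "riemannian_manifold M" and "minimizing_geodesic M \<gamma> 0 1"
  shows "tnorm M (\<gamma> 0) (riem_log M (\<gamma> 0) (\<gamma> 1)) = geo_dist M (\<gamma> 0) (\<gamma> 1)"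
proof -
  let ?P = "\<lambda>v. \<exists>\<sigma>. minimizing_geodesic M \<sigma> 0 1 \<and> \<sigma> 0 = \<gamma> 0 \<and> \<sigma> 1 = \<gamma> 1 \<and> velocity M \<sigma> 0 = v"
  have "?P (riem_log M (\<gamma> 0) (\<gamma> 1))"
    unfolding riem_log_def by (rule someI_ex) (use assms(2) in blast)
  then obtain \<sigma> where \<sigma>: "minimizing_geodesic M \<sigma> 0 1" "\<sigma> 0 = \<gamma> 0" "\<sigma> 1 = \<gamma> 1"
      "velocity M \<sigma> 0 = riem_log M (\<gamma> 0) (\<gamma> 1)"
    by blast
  then show ?thesis
    using geodesic_curve_length[OF M] unfolding minimizing_geodesic_def by metis
qed

section \<open>Boundedness\<close>

text \<open>By compactness the quadratic form has a positive minimum on the unit sphere; by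
  homogeneity of degree 2 the constant is the inverse square root of that minimum.\<close>

lemma bilinear_pos_norm_le:
  fixes B :: "'a::euclidean_space \<Rightarrow> 'a \<Rightarrow> real"
  assumes B: "bilinear B" and pos: "\<And>v. v \<noteq> 0 \<Longrightarrow> 0 < B v v"
  obtains C where "0 \<le> C" and "\<And>v. norm v \<le> C * sqrt (B v v)"
proof -
  have "bounded_bilinear B"
    using B bilinear_conv_bounded_bilinear by blast
  then have "continuous_on (sphere 0 1) (\<lambda>v. B v v)"
    by (rule bounded_bilinear.continuous_on) (rule continuous_on_id)+
  moreover have "sphere (0::'a) 1 \<noteq> {}"
    by simp
  ultimately obtain w where w: "w \<in> sphere 0 1" "\<And>v. v \<in> sphere 0 1 \<Longrightarrow> B w w \<le> B v v"
    using continuous_attains_inf[OF compact_sphere] by blast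
  have "0 < B w w"
    using w(1) by (intro pos) auto
  have "norm v \<le> 1 / sqrt (B w w) * sqrt (B v v)" for v
  proof (cases "v = 0")
    case False
    have "B w w \<le> B (v /\<^sub>R norm v) (v /\<^sub>R norm v)"
      using False by (intro w(2)) simp
    also have "\<dots> = B v v / (norm v)\<^sup>2"
      by (simp add: bilinear_lmul[OF B] bilinear_rmul[OF B] power2_eq_square divide_inverse)
    finally have "(norm v)\<^sup>2 * B w w \<le> B v v"
      using False by (simp add: field_simps)
    then have "sqrt ((norm v)\<^sup>2 * B w w) \<le> sqrt (B v v)"
      by (rule real_sqrt_le_mono)
    then show ?thesis
      using \<open>0 < B w w\<close> by (simp add: real_sqrt_mult field_simps)
  qed (simp add: bilinear_lzero[OF B])
  then show thesis
    using \<open>0 < B w w\<close> that[of "1 / sqrt (B w w)"] by simp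
qed

lemma norm_le_tnorm:
  assumes M: "riemannian_manifold M"
  obtains C where "0 \<le> C" and "\<And>v. norm v \<le> C * tnorm M p v"
  using bilinear_pos_norm_le[OF bilinear_metric[OF M] metric_pos[OF M], of p] unfolding tnorm_def by blast

lemma norm_le_tnorm_prod:
  assumes M: "riemannian_manifold M" and N: "riemannian_manifold N"
  obtains C where "0 \<le> C" and "\<And>v. norm v \<le> C * tnorm (prod_riem M N) m v"
proof -
  obtain C where C: "0 \<le> C" "\<And>v. norm v \<le> C * tnorm M (fst m) v"
    using norm_le_tnorm[OF M, of "fst m"] by blast
  obtain D where D: "0 \<le> D" "\<And>v. norm v \<le> D * tnorm N (snd m) v"
    using norm_le_tnorm[OF N, of "snd m"] by blast
  have "norm v \<le> (C + D) * tnorm (prod_riem M N) m v" for v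
  proof -
    have "norm v \<le> norm (fst v) + norm (snd v)"
      using norm_Pair_le[of "fst v" "snd v"] by simp
    also have "\<dots> \<le> C * tnorm M (fst m) (fst v) + D * tnorm N (snd m) (snd v)"
      by (intro add_mono C(2) D(2))
    also have "\<dots> \<le> C * tnorm (prod_riem M N) m v + D * tnorm (prod_riem M N) m v"
      unfolding tnorm_prod[OF M N] using C(1) D(1) by (intro add_mono mult_left_mono) auto
    finally show ?thesis
      by (simp add: algebra_simps)
  qed
  then show thesis
    using C(1) D(1) that[of "C + D"] by simp
qed

text \<open>The properties of the preferred chart at \<open>p\<close> appear as hypotheses so that
  they can be checked directly for \<open>prod_riem M N\<close>. Compatibility of \<open>c\<close>
  with the atlas makes the transition map differentiable.\<close>

lemma bounded_linear_to_coord: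
  assumes "chart_at M p \<in> atlas M" and "p \<in> cdom (chart_at M p)" and "c \<in> charts M" and "p \<in> cdom c"
  shows "bounded_linear (to_coord M c p)"
proof -
  let ?d = "chart_at M p"
  have "smooth_on (cmap ?d ` (cdom c \<inter> cdom ?d)) (cmap c \<circ> cinv ?d)"
    using assms by (auto simp: charts_def compatible_def)
  then have "((cmap c \<circ> cinv ?d) has_derivative
      frechet_derivative (cmap c \<circ> cinv ?d) (at (cmap ?d p))) (at (cmap ?d p))"
    by (rule smooth_on_has_derivative) (use assms in blast)
  moreover have "to_coord M c p = frechet_derivative (cmap c \<circ> cinv ?d) (at (cmap ?d p))"
    by (auto simp: to_coord_def)
  ultimately show ?thesis
    by (simp add: has_derivative_bounded_linear)
qed

lemma bounded_linear_inv:
  fixes J :: "'a::euclidean_space \<Rightarrow> 'b::euclidean_space"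
  assumes J: "linear J" and "bij J"
  shows "bounded_linear (inv J)"
proof -
  have "linear (inv J)"
    by (rule linearI)
      (use J \<open>bij J\<close> in \<open>auto intro!: inv_f_eq bij_is_inj simp: linear_add linear_scale surj_f_inv_f bij_is_surj\<close>)
  then show ?thesis
    by (simp add: linear_conv_bounded_linear)
qed

section \<open>Elementary inequalities and the norm of \<open>psi\<close>\<close>

lemma weighted_sum_ge:
  fixes a b :: real
  assumes "\<alpha> \<in> {\<epsilon>..2 - \<epsilon>}" and "0 \<le> a" and "0 \<le> b"
  shows "\<epsilon> * (a + b) \<le> \<alpha> * a + (2 - \<alpha>) * b"
  using mult_right_mono[of \<epsilon> \<alpha> a] mult_right_mono[of \<epsilon> "2 - \<alpha>" b] assms
  by (auto simp: distrib_left)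

lemma sqrt_ratio_le:
  fixes a b :: real
  assumes "\<alpha> \<in> {\<epsilon>..2 - \<epsilon>}" and "0 < \<epsilon>" and "0 \<le> a" and "0 \<le> b"
  shows "sqrt (a + b) / sqrt (\<alpha> * a + (2 - \<alpha>) * b) \<le> 1 / sqrt \<epsilon>"
proof (cases "a + b = 0")
  \<comment> \<open>Here the left-hand side is 0/0, which is 0.\<close>
  case True
  then have "a = 0" "b = 0"
    using assms by auto
  then show ?thesis
    using \<open>0 < \<epsilon>\<close> by simp
next
  case False
  then have pos: "0 < a + b"
    using assms by auto
  have "sqrt \<epsilon> * sqrt (a + b) \<le> sqrt (\<alpha> * a + (2 - \<alpha>) * b)"
    using weighted_sum_ge[OF assms(1,3,4)] by (simp flip: real_sqrt_mult)
  moreover have "0 < \<alpha> * a + (2 - \<alpha>) * b"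
    using weighted_sum_ge[OF assms(1,3,4)] pos \<open>0 < \<epsilon>\<close> by (smt (verit) mult_pos_pos)
  ultimately show ?thesis
    using \<open>0 < \<epsilon>\<close> by (simp add: field_simps)
qed

lemma balance_ratio_le:
  fixes x y :: real
  assumes "0 \<le> x" and "0 \<le> y"
  shows "\<bar>(x - y) / (x + y)\<bar> \<le> 1"
  using assms by (cases "x + y = 0") (auto simp: abs_le_iff field_simps)

lemma tnorm_psi:
  assumes M: "riemannian_manifold M" and N: "riemannian_manifold N" and \<alpha>: "0 \<le> \<alpha>" "\<alpha> \<le> 2"
    and z: "z \<notin> cut_locus (prod_riem M N) m"
  shows "tnorm (prod_riem M N) m (psi M N \<alpha> z m) =
    sqrt (A_sq M m z + B_sq N m z) / sqrt (\<alpha> * A_sq M m z + (2 - \<alpha>) * B_sq N m z)"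
proof -
  \<comment> \<open>The negation of the universal condition in \<open>cut_locus\<close> supplies a
    minimizing geodesic from \<open>m\<close> to \<open>z\<close>.\<close>
  obtain \<gamma> where \<gamma>: "minimizing_geodesic (prod_riem M N) \<gamma> 0 1" "\<gamma> 0 = m" "\<gamma> 1 = z"
    using z unfolding cut_locus_def by blast
  have log: "tnorm M (fst m) (riem_log M (fst m) (fst z)) = geo_dist M (fst m) (fst z)"
      "tnorm N (snd m) (riem_log N (snd m) (snd z)) = geo_dist N (snd m) (snd z)"
    using tnorm_riem_log[OF M minimizing_geodesic_prod(1)[OF M N \<gamma>(1)]]
      tnorm_riem_log[OF N minimizing_geodesic_prod(2)[OF M N \<gamma>(1)]] \<gamma>(2,3) by auto
  define d where "d = d_alpha M N \<alpha> m z"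
  have d: "d = sqrt (\<alpha> * A_sq M m z + (2 - \<alpha>) * B_sq N m z)"
    by (simp add: d_def d_alpha_def A_sq_def B_sq_def)
  \<comment> \<open>The value \<open>d = 0\<close> is allowed: the inverse of 0 is 0, so both sides
    of the claim vanish.\<close>
  have "0 \<le> d"
    using \<alpha> by (simp add: d A_sq_def B_sq_def)
  have "tnorm (prod_riem M N) m (psi M N \<alpha> z m) =
      sqrt ((geo_dist M (fst m) (fst z) / d)\<^sup>2 + (geo_dist N (snd m) (snd z) / d)\<^sup>2)"
    using \<open>0 \<le> d\<close>
    by (simp add: psi_def prod_log_def tnorm_prod[OF M N] tnorm_scaleR[OF M] tnorm_scaleR[OF N] log
        divide_inverse mult.commute flip: d_def)
  also have "\<dots> = sqrt ((A_sq M m z + B_sq N m z) / d\<^sup>2)"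
    by (simp add: A_sq_def B_sq_def power_divide add_divide_distrib)
  also have "\<dots> = sqrt (A_sq M m z + B_sq N m z) / d"
    using \<open>0 \<le> d\<close> by (simp add: real_sqrt_divide)
  finally show ?thesis
    unfolding d .
qed

theorem mainTheorem12:
  fixes M :: "('m::{t2_space,second_countable_topology}, 'e::euclidean_space) riem"
    and N :: "('n::{t2_space,second_countable_topology}, 'f::euclidean_space) riem"
    and P :: "'w measure"
    and Z :: "'w \<Rightarrow> 'm \<times> 'n"
    and \<epsilon> :: real
  assumes "complete_connected_riemannian_manifold M"
    and "complete_connected_riemannian_manifold N"
    and "prob_space P" and "Z \<in> borel_measurable P"
    and "0 < \<epsilon>" and "\<epsilon> < 1"
  shows "(\<forall>\<alpha>\<in>{\<epsilon>..2 - \<epsilon>}. \<forall>m. \<forall>z. z \<notin> cut_locus (prod_riem M N) m \<union> {m} \<longrightarrow>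
            tnorm (prod_riem M N) m (psi M N \<alpha> z m)
              = sqrt (A_sq M m z + B_sq N m z) / sqrt (\<alpha> * A_sq M m z + (2 - \<alpha>) * B_sq N m z) \<and>
            sqrt (A_sq M m z + B_sq N m z) / sqrt (\<alpha> * A_sq M m z + (2 - \<alpha>) * B_sq N m z)
              \<le> 1 / sqrt \<epsilon> \<and>
            \<bar>h_bal M N \<alpha> z m\<bar> \<le> 1) \<and>
         (\<forall>m\<^sub>0. \<forall>\<alpha>\<^sub>0\<in>{\<epsilon>..2 - \<epsilon>}. \<forall>c\<in>charts (prod_riem M N). \<forall>J.
            m\<^sub>0 \<in> cdom c \<and>
            Xi_mean_exists M N c P Z \<alpha>\<^sub>0 m\<^sub>0 \<and> Xi_mean M N c P Z \<alpha>\<^sub>0 m\<^sub>0 = 0 \<and>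
            has_Xi_Jacobian M N c P Z \<alpha>\<^sub>0 m\<^sub>0 J \<and> bij J \<longrightarrow>
            bounded (IF_bal M N c J \<alpha>\<^sub>0 m\<^sub>0 ` {z. z \<notin> cut_locus (prod_riem M N) m\<^sub>0 \<union> {m\<^sub>0}}))"
proof (rule conjI)
  have M: "riemannian_manifold M" and N: "riemannian_manifold N"
    using assms(1,2) by (simp_all add: complete_connected_riemannian_manifold_def)
  note SM = riemannian_smooth[OF M] and SN = riemannian_smooth[OF N]
  have psi: "tnorm (prod_riem M N) m (psi M N \<alpha> z m)
        = sqrt (A_sq M m z + B_sq N m z) / sqrt (\<alpha> * A_sq M m z + (2 - \<alpha>) * B_sq N m z)"
    if "\<alpha> \<in> {\<epsilon>..2 - \<epsilon>}" "z \<notin> cut_locus (prod_riem M N) m" for \<alpha> m z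
    using that \<open>0 < \<epsilon>\<close> by (intro tnorm_psi M N) auto
  have ratio: "sqrt (A_sq M m z + B_sq N m z) / sqrt (\<alpha> * A_sq M m z + (2 - \<alpha>) * B_sq N m z) \<le> 1 / sqrt \<epsilon>"
    if "\<alpha> \<in> {\<epsilon>..2 - \<epsilon>}" for \<alpha> m z
    by (rule sqrt_ratio_le[OF that \<open>0 < \<epsilon>\<close>]) (simp_all add: A_sq_def B_sq_def)
  have h: "\<bar>h_bal M N \<alpha> z m\<bar> \<le> 1" if "\<alpha> \<in> {\<epsilon>..2 - \<epsilon>}" for \<alpha> m z
    unfolding h_bal_def using that \<open>0 < \<epsilon>\<close>
    by (intro balance_ratio_le) (auto simp: A_sq_def B_sq_def)
  show "\<forall>\<alpha>\<in>{\<epsilon>..2 - \<epsilon>}. \<forall>m. \<forall>z. z \<notin> cut_locus (prod_riem M N) m \<union> {m} \<longrightarrow>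
            tnorm (prod_riem M N) m (psi M N \<alpha> z m)
              = sqrt (A_sq M m z + B_sq N m z) / sqrt (\<alpha> * A_sq M m z + (2 - \<alpha>) * B_sq N m z) \<and>
            sqrt (A_sq M m z + B_sq N m z) / sqrt (\<alpha> * A_sq M m z + (2 - \<alpha>) * B_sq N m z)
              \<le> 1 / sqrt \<epsilon> \<and>
            \<bar>h_bal M N \<alpha> z m\<bar> \<le> 1"
    using psi ratio h by blast
  show "\<forall>m\<^sub>0. \<forall>\<alpha>\<^sub>0\<in>{\<epsilon>..2 - \<epsilon>}. \<forall>c\<in>charts (prod_riem M N). \<forall>J.
            m\<^sub>0 \<in> cdom c \<and>
            Xi_mean_exists M N c P Z \<alpha>\<^sub>0 m\<^sub>0 \<and> Xi_mean M N c P Z \<alpha>\<^sub>0 m\<^sub>0 = 0 \<and>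
            has_Xi_Jacobian M N c P Z \<alpha>\<^sub>0 m\<^sub>0 J \<and> bij J \<longrightarrow>
            bounded (IF_bal M N c J \<alpha>\<^sub>0 m\<^sub>0 ` {z. z \<notin> cut_locus (prod_riem M N) m\<^sub>0 \<union> {m\<^sub>0}})"
  proof (intro allI ballI impI, elim conjE)
    fix m\<^sub>0 \<alpha>\<^sub>0 c J
    assume \<alpha>: "\<alpha>\<^sub>0 \<in> {\<epsilon>..2 - \<epsilon>}" and c: "c \<in> charts (prod_riem M N)" "m\<^sub>0 \<in> cdom c"
      and J: "has_Xi_Jacobian M N c P Z \<alpha>\<^sub>0 m\<^sub>0 J" "bij J"
    have "chart_at (prod_riem M N) m\<^sub>0 \<in> atlas (prod_riem M N)"
      unfolding prod_riem_simps using chart_at_atlas(1)[OF SM] chart_at_atlas(1)[OF SN] by blast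
    moreover have "m\<^sub>0 \<in> cdom (chart_at (prod_riem M N) m\<^sub>0)"
      using chart_at_atlas(2)[OF SM] chart_at_atlas(2)[OF SN] by (simp add: mem_Times_iff)
    ultimately have "bounded_linear (to_coord (prod_riem M N) c m\<^sub>0)"
      using c by (rule bounded_linear_to_coord)
    \<comment> \<open>The constants \<open>K\<close>, \<open>C\<close> and \<open>L\<close> come
      from the chart, the metric at \<open>m\<^sub>0\<close> and the inverse Jacobian; none of them
      depends on \<open>z\<close>.\<close>
    then obtain K where K: "0 < K" "\<And>v. norm (to_coord (prod_riem M N) c m\<^sub>0 v) \<le> norm v * K"
      using bounded_linear.pos_bounded by blast
    obtain C where C: "0 \<le> C" "\<And>v. norm v \<le> C * tnorm (prod_riem M N) m\<^sub>0 v"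
      using norm_le_tnorm_prod[OF M N, of m\<^sub>0] by blast
    \<comment> \<open>Linearity is part of \<open>J\<close> being a derivative; together with
      bijectivity and finite dimension it makes the inverse bounded.\<close>
    have "linear J"
      using J(1) unfolding has_Xi_Jacobian_def by (blast intro: has_derivative_linear)
    then obtain L where L: "0 < L" "\<And>x. norm (inv J x) \<le> norm x * L"
      using bounded_linear.pos_bounded[OF bounded_linear_inv[OF _ J(2)]] by blast
    show "bounded (IF_bal M N c J \<alpha>\<^sub>0 m\<^sub>0 ` {z. z \<notin> cut_locus (prod_riem M N) m\<^sub>0 \<union> {m\<^sub>0}})"
      unfolding bounded_iff
    proof (intro exI ballI, elim imageE)
      fix w z assume w: "w = IF_bal M N c J \<alpha>\<^sub>0 m\<^sub>0 z"
        and "z \<in> {z. z \<notin> cut_locus (prod_riem M N) m\<^sub>0 \<union> {m\<^sub>0}}"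
      then have z: "z \<notin> cut_locus (prod_riem M N) m\<^sub>0"
        by blast
      let ?\<psi> = "psi M N \<alpha>\<^sub>0 z m\<^sub>0"
      \<comment> \<open>Boundedness in the metric at \<open>m\<^sub>0\<close> is passed on to the
        Euclidean norm by \<open>C\<close>, to the coordinates of \<open>c\<close> by
        \<open>K\<close> and through the inverse Jacobian by \<open>L\<close>; the summand 1
        accounts for the component \<open>h_bal\<close>.\<close>
      have "norm ?\<psi> \<le> C * (1 / sqrt \<epsilon>)"
        using C(2)[of ?\<psi>] mult_left_mono[OF ratio[OF \<alpha>] C(1)] unfolding psi[OF \<alpha> z] by (rule order_trans)
      then have "norm (to_coord (prod_riem M N) c m\<^sub>0 ?\<psi>) \<le> C * (1 / sqrt \<epsilon>) * K"
        using K by (meson mult_right_mono less_imp_le order_trans)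
      then have "norm (Xi M N c \<alpha>\<^sub>0 z m\<^sub>0) \<le> C * (1 / sqrt \<epsilon>) * K + 1"
        unfolding Xi_def using h[OF \<alpha>, of z m\<^sub>0]
        by (intro order_trans[OF norm_Pair_le] add_mono) auto
      then show "norm w \<le> (C * (1 / sqrt \<epsilon>) * K + 1) * L"
        unfolding w IF_bal_def norm_minus_cancel
        using L by (meson mult_right_mono less_imp_le order_trans)
    qed
  qed
qed

end
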